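(* Let $x$ be an odd integer with $x>1$, let $t\ge2$ be an integer, and let $a,b,c\ge0$ be integers with $b+c\ge1$. Let $L=\{1^a,x^b,(tx)^c\}$, of size $v-1$ where $v=a+b+c+1$, and suppose $v\ge(t+2)x$. Write $v=qx+r$ with $0\le r<x$ and let $s=\lfloor q/(2t)\rfloor$. If $a\ge\omega(x,b+c)$, then $L$ has a standard linear realization whenever one of the following holds: (1) $r$ is even and $b\ge tx$; (2) $r$ and $t$ are odd and $b\ge tx+2t-3$; (3) $r$ is odd, $t$ is even, and $b\ge 4s+tx+4t-9$.
   Context: For a positive integer $n$, $K_n$ is the complete graph on vertex set $\{0,\dots,n-1\}$ and the linear length of an edge $\{u,w\}$ is $|u-w|$. A multiset of positive integers of size $n-1$ has a linear realization if some Hamiltonian path in $K_n$ has multiset of linear edge lengths equal to it; it is standard if the path starts at $0$. $\{x_1^{a_1},\dots\}$ denotes the multiset with $x_i$ of multiplicity $a_i$. For integers $z\ge2$, $d\ge0$, $\omega(z,d)$ is the smallest integer $a\ge0$ such that $\{1^a,z^d\}$ has a standard linear realization. *)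

theory Defs
  imports Main "HOL-Library.Multiset"
begin

text \<open>
  A path is represented by the list of its vertices in order. Any two distinct vertices of
  \<open>K\<^sub>n\<close> are adjacent, so consecutive entries of a list without repetitions automatically
  span an edge, and a Hamiltonian path is a repetition-free list of all the vertices.
\<close>

definition hamiltonian_path_K :: "nat \<Rightarrow> nat list \<Rightarrow> bool" where
  "hamiltonian_path_K n p \<longleftrightarrow> distinct p \<and> set p = {0..<n}"

definition linear_length :: "nat \<Rightarrow> nat \<Rightarrow> nat" where
  "linear_length u w = nat \<bar>int u - int w\<bar>"

definition edge_lengths :: "nat list \<Rightarrow> nat multiset" where
  "edge_lengths p = mset (map (\<lambda>(u, w). linear_length u w) (zip p (tl p)))"

text \<open>
  The order \<open>n\<close> of the complete graph is determined by the multiset: \<open>n - 1 = size L\<close>.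
\<close>

definition linear_realization :: "nat multiset \<Rightarrow> nat list \<Rightarrow> bool" where
  "linear_realization L p \<longleftrightarrow> hamiltonian_path_K (size L + 1) p \<and> edge_lengths p = L"

definition has_standard_linear_realization :: "nat multiset \<Rightarrow> bool" where
  "has_standard_linear_realization L \<longleftrightarrow> (\<exists>p. linear_realization L p \<and> hd p = 0)"

definition omega :: "nat \<Rightarrow> nat \<Rightarrow> nat" where
  "omega z d =
    (LEAST a. has_standard_linear_realization (replicate_mset a 1 + replicate_mset d z))"

end

(*
  Modulo x the vertices split into columns, on which edges of length x and tx act as edges of
  length 1 and t between the levels. A path visits the columns in cyclic order, 0, 1, ..., x - 1 or
  0, x - 1, ..., 1, changing columns by edges of length 1. Two neighbouring columns of equal height
  are traversed by a path and its reverse, so that only standard paths with lengths 1 and t inside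
  a column are needed; these are snakes through the residue classes modulo t, with about t edges of
  length 1. Writing e = (b + c) mod x, this uses x - 1 edges of length 1 if e is even or e = 1; for
  other odd e one more edge of length 1 is spent on splitting a column. Further ones are absorbed
  by prepending vertices. Conversely, a realization of {1^(x-1), x^d} must use every pair at
  distance x, which fixes its edges up to little choice and is impossible for odd d mod x >= 3, so
  omega is large enough for the constructions.
*)

theory Submission
  imports Defs
begin

subsection \<open>Paths with prescribed vertex set, end points and edge lengths\<close>

text \<open>All three alternatives give \<open>b \<ge> t * x\<close>, so with
  \<open>b + c = (t + k) * x + e\<close> at most \<open>x * k + e\<close> edges of length
  \<open>t * x\<close> have to be placed. The columns have height \<open>n = t + 1 + k\<close> or
  \<open>n + 1\<close>. A path through \<open>N \<ge> t\<close> levels meets all residues modulo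
  \<open>t\<close>, so it has at least \<open>t - 1\<close> steps of length \<open>1\<close> and at
  most \<open>N - t\<close> of length \<open>t\<close>. The snakes attain this unless
  \<open>t\<close> and \<open>N mod t\<close> are odd, \<open>N mod t \<ge> 3\<close> and
  \<open>N > 2 * t\<close>; then they miss it by one. So \<open>k\<close> and \<open>k + 1\<close>
  are always available in the two kinds of column, which for even \<open>e\<close> adds up to
  exactly \<open>x * k + e\<close>. The other obstacle is that a mirrored pair of columns carries an
  even number of long edges. The parity of \<open>c\<close> is adjusted in a single column, or for
  odd \<open>e \<ge> 3\<close> in the three columns sharing the additional edge, whose possible
  totals are limited. The extreme totals still fit because \<open>n\<close> and \<open>n + 1\<close>
  cannot both be bad: below a height of odd residue at least 3 lies one of even residue.\<close>

definition hpath :: "nat multiset \<Rightarrow> nat set \<Rightarrow> nat \<Rightarrow> nat \<Rightarrow> bool" where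
  "hpath M S u w \<longleftrightarrow>
    (\<exists>p. p \<noteq> [] \<and> distinct p \<and> set p = S \<and> hd p = u \<and> last p = w \<and> edge_lengths p = M)"

lemma linear_length_eq: "linear_length u w = (if u \<le> w then w - u else u - w)"
  by (auto simp: linear_length_def)

lemma linear_length_commute: "linear_length u w = linear_length w u"
  by (auto simp: linear_length_eq)

lemma edge_lengths_simps [simp]:
  "edge_lengths [] = {#}"
  "edge_lengths [u] = {#}"
  "edge_lengths (u # w # p) = add_mset (linear_length u w) (edge_lengths (w # p))"
  by (auto simp: edge_lengths_def)

lemma edge_lengths_Cons:
  "p \<noteq> [] \<Longrightarrow> edge_lengths (u # p) = add_mset (linear_length u (hd p)) (edge_lengths p)"
  by (cases p) auto

lemma edge_lengths_append:
  assumes "q \<noteq> []"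
  shows "p \<noteq> [] \<Longrightarrow> edge_lengths (p @ q) =
    add_mset (linear_length (last p) (hd q)) (edge_lengths p + edge_lengths q)"
proof (induction p)
  case (Cons u p)
  show ?case
  proof (cases "p = []")
    case True
    then show ?thesis using assms by (simp add: edge_lengths_Cons)
  next
    case False
    then show ?thesis using Cons.IH by (simp add: edge_lengths_Cons)
  qed
qed simp

lemma edge_lengths_rev: "edge_lengths (rev p) = edge_lengths p"
proof (induction p)
  case (Cons u p)
  then show ?case
    by (cases "p = []")
      (simp_all add: edge_lengths_append edge_lengths_Cons last_rev linear_length_commute)
qed simp

lemma edge_lengths_map:
  assumes "\<And>u w. linear_length (f u) (f w) = g (linear_length u w)"
  shows "edge_lengths (map f p) = image_mset g (edge_lengths p)"
proof (induction p)
  case (Cons u p)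
  then show ?case
    by (cases "p = []") (simp_all add: edge_lengths_Cons assms hd_map)
qed simp

lemma size_edge_lengths: "size (edge_lengths p) = length p - 1"
  by (simp add: edge_lengths_def)

lemma replicate_mset_add: "replicate_mset (m + n) y = replicate_mset m y + replicate_mset n y"
  by (induction m) auto

lemma hpath_single: "hpath {#} {u} u u"
  unfolding hpath_def by (rule exI[of _ "[u]"]) simp

lemma hpath_rev: "hpath M S u w \<Longrightarrow> hpath M S w u"
  unfolding hpath_def
  by (metis distinct_rev edge_lengths_rev hd_rev last_rev rev_is_Nil_conv set_rev)

lemma hpath_append:
  assumes "hpath M S u w" "hpath N T u' w'" "S \<inter> T = {}" "linear_length w u' = d"
  shows "hpath (add_mset d (M + N)) (S \<union> T) u w'"
proof -
  obtain p where p: "p \<noteq> []" "distinct p" "set p = S" "hd p = u" "last p = w" "edge_lengths p = M"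
    using assms(1) by (auto simp: hpath_def)
  obtain q where q: "q \<noteq> []" "distinct q" "set q = T" "hd q = u'" "last q = w'" "edge_lengths q = N"
    using assms(2) by (auto simp: hpath_def)
  show ?thesis
    unfolding hpath_def
    by (rule exI[of _ "p @ q"]) (use p q assms(3,4) in \<open>simp add: edge_lengths_append\<close>)
qed

lemma hpath_map:
  assumes "hpath M S u w" "inj f" "\<And>u w. linear_length (f u) (f w) = g (linear_length u w)"
  shows "hpath (image_mset g M) (f ` S) (f u) (f w)"
proof -
  obtain p where p: "p \<noteq> []" "distinct p" "set p = S" "hd p = u" "last p = w" "edge_lengths p = M"
    using assms(1) by (auto simp: hpath_def)
  show ?thesis
    unfolding hpath_def
    by (rule exI[of _ "map f p"])
      (use p assms(2) in \<open>simp add: edge_lengths_map[of f g, OF assms(3)] distinct_map hd_map last_map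
        inj_on_subset[OF assms(2)]\<close>)
qed

lemma hpath_shift: "hpath M S u w \<Longrightarrow> hpath M (Suc ` S) (Suc u) (Suc w)"
  using hpath_map[of M S u w Suc id] by (simp add: linear_length_eq)

lemma hpath_size: "hpath M S u w \<Longrightarrow> Suc (size M) = card S"
  unfolding hpath_def
  by (metis One_nat_def Suc_pred distinct_card length_greater_0_conv size_edge_lengths)

lemma hpath_in: "hpath M S u w \<Longrightarrow> u \<in> S \<and> w \<in> S"
  unfolding hpath_def by auto

lemma hpath_run: "i \<le> j \<Longrightarrow> hpath (replicate_mset (j - i) 1) {i..j} i j"
proof (induction "j - i" arbitrary: j)
  case 0
  then show ?case using hpath_single[of i] by simp
next
  case (Suc m)
  then obtain j' where j: "j = Suc j'" "i \<le> j'" "m = j' - i"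
    by (cases j) auto
  have "hpath (add_mset 1 (replicate_mset (j' - i) 1 + {#})) ({i..j'} \<union> {j}) i j"
    by (rule hpath_append[OF Suc.hyps(1) hpath_single]) (use j in \<open>auto simp: linear_length_eq\<close>)
  then show ?case using j by (simp add: atLeastAtMostSuc_conv Suc_diff_le insert_commute)
qed

subsection \<open>Columns and levels\<close>

text \<open>
  Modulo \<open>x\<close> the vertices split into columns, on which \<open>div x\<close> gives the level. Edges of length
  \<open>x\<close> and \<open>t * x\<close> stay in a column and change the level by \<open>1\<close> and \<open>t\<close>. In \<open>hp3\<close>
  the number of edges of length \<open>x\<close>, and in \<open>lev\<close> that of edges of length \<open>1\<close>, is
  left implicit since it is determined by the number of vertices.
\<close>

definition hp3 :: "nat \<Rightarrow> nat \<Rightarrow> nat \<Rightarrow> nat \<Rightarrow> nat set \<Rightarrow> nat \<Rightarrow> nat \<Rightarrow> bool" where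
  "hp3 x t a c S u w \<longleftrightarrow>
    (\<exists>b. hpath (replicate_mset a 1 + replicate_mset b x + replicate_mset c (t * x)) S u w)"

definition lev :: "nat \<Rightarrow> nat \<Rightarrow> nat set \<Rightarrow> nat \<Rightarrow> nat \<Rightarrow> bool" where
  "lev t c S u w \<longleftrightarrow> (\<exists>b. hpath (replicate_mset b 1 + replicate_mset c t) S u w)"

definition blk :: "nat \<Rightarrow> nat set \<Rightarrow> nat set \<Rightarrow> nat set" where
  "blk x J A = {y. y mod x \<in> J \<and> y div x \<in> A}"

lemma hp3_rev: "hp3 x t a c S u w \<Longrightarrow> hp3 x t a c S w u"
  unfolding hp3_def using hpath_rev by blast

lemma lev_rev: "lev t c S u w \<Longrightarrow> lev t c S w u"
  unfolding lev_def using hpath_rev by blast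

lemma lev_in: "lev t c S u w \<Longrightarrow> u \<in> S \<and> w \<in> S"
  unfolding lev_def using hpath_in by blast

lemma hp3_append:
  assumes "hp3 x t a c S u w" "hp3 x t a' c' T u' w'" "S \<inter> T = {}" "linear_length w u' = 1"
  shows "hp3 x t (Suc (a + a')) (c + c') (S \<union> T) u w'"
proof -
  obtain b b' where
    "hpath (replicate_mset a 1 + replicate_mset b x + replicate_mset c (t * x)) S u w"
    "hpath (replicate_mset a' 1 + replicate_mset b' x + replicate_mset c' (t * x)) T u' w'"
    using assms(1,2) unfolding hp3_def by blast
  from hpath_append[OF this assms(3,4)] show ?thesis
    unfolding hp3_def
    by (intro exI[of _ "b + b'"]) (simp add: replicate_mset_add add_ac)
qed

lemma lev_append:
  assumes "lev t c S u w" "lev t c' T u' w'" "S \<inter> T = {}" "linear_length w u' = 1"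
  shows "lev t (c + c') (S \<union> T) u w'"
proof -
  obtain b b' where
    "hpath (replicate_mset b 1 + replicate_mset c t) S u w"
    "hpath (replicate_mset b' 1 + replicate_mset c' t) T u' w'"
    using assms(1,2) unfolding lev_def by blast
  from hpath_append[OF this assms(3,4)] show ?thesis
    unfolding lev_def
    by (intro exI[of _ "Suc (b + b')"]) (simp add: replicate_mset_add add_ac)
qed

lemma lev_append_long:
  assumes "lev t c S u w" "lev t c' T u' w'" "S \<inter> T = {}" "linear_length w u' = t"
  shows "lev t (Suc (c + c')) (S \<union> T) u w'"
proof -
  obtain b b' where
    "hpath (replicate_mset b 1 + replicate_mset c t) S u w"
    "hpath (replicate_mset b' 1 + replicate_mset c' t) T u' w'"
    using assms(1,2) unfolding lev_def by blast
  from hpath_append[OF this assms(3,4)] show ?thesis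
    unfolding lev_def
    by (intro exI[of _ "b + b'"]) (simp add: replicate_mset_add add_ac)
qed

lemma lev_run: "i \<le> j \<Longrightarrow> lev t 0 {i..j} i j"
  unfolding lev_def using hpath_run[of i j] by (intro exI[of _ "j - i"]) simp

lemma lev_run_down: "i \<le> j \<Longrightarrow> lev t 0 {i..j} j i"
  by (rule lev_rev[OF lev_run])

lemma lev_single: "lev t 0 {u} u u"
  using lev_run[of u u t] by simp

lemma lev_up: "0 < h \<Longrightarrow> lev t 0 {..<h} 0 (h - 1)"
  using lev_run[of 0 "h - 1" t] by (simp add: atLeast0AtMost lessThan_Suc_atMost[symmetric])

lemma lev_shift: "lev t c S u w \<Longrightarrow> lev t c (Suc ` S) (Suc u) (Suc w)"
  unfolding lev_def using hpath_shift by blast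

text \<open>A new level below costs one edge of length \<open>1\<close>, so existence of paths is
  monotone in the height.\<close>

lemma lev_prepend:
  assumes "lev t c S 0 w"
  shows "lev t c (insert 0 (Suc ` S)) 0 (Suc w)"
  using lev_append[OF lev_single[of t 0] lev_shift[OF assms]] by (auto simp: linear_length_eq)

lemma lev_column:
  assumes "lev t c A u w" "j < x"
  shows "hp3 x t 0 c (blk x {j} A) (u * x + j) (w * x + j)"
proof -
  let ?f = "\<lambda>l. l * x + j"
  obtain b where b: "hpath (replicate_mset b 1 + replicate_mset c t) A u w"
    using assms(1) unfolding lev_def by blast
  have "inj ?f" using assms(2) by (auto simp: inj_on_def)
  moreover have "linear_length (?f u) (?f w) = linear_length u w * x" for u w
    by (auto simp: linear_length_eq diff_mult_distrib dest: not_le_imp_less)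
  moreover have "?f ` A = blk x {j} A"
  proof (intro set_eqI iffI)
    fix y assume "y \<in> blk x {j} A"
    then have "y = ?f (y div x)" "y div x \<in> A" by (auto simp: blk_def)
    then show "y \<in> ?f ` A" by blast
  qed (use assms(2) in \<open>auto simp: blk_def\<close>)
  ultimately have "hpath (image_mset (\<lambda>l. l * x) (replicate_mset b 1 + replicate_mset c t))
      (blk x {j} A) (?f u) (?f w)"
    using hpath_map[OF b, of ?f "\<lambda>l. l * x"] by simp
  then show ?thesis unfolding hp3_def by (intro exI[of _ b]) simp
qed

text \<open>The column lemmas are used a second time with modulus \<open>t\<close>: the residue
  classes of the levels modulo \<open>t\<close> are then the columns, and the third length
  \<open>s * t\<close> has multiplicity \<open>0\<close>. Counting the edges of length
  \<open>1\<close> suffices to know those of length \<open>t\<close>.\<close>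

lemma hp3_lev:
  assumes "hp3 t s a 0 S u w" "card S = N"
  shows "lev t (N - 1 - a) S u w"
proof -
  obtain b where b: "hpath (replicate_mset a 1 + replicate_mset b t) S u w"
    using assms(1) unfolding hp3_def by auto
  have "b = N - 1 - a" using hpath_size[OF b] assms(2) by simp
  then show ?thesis using b unfolding lev_def by blast
qed

text \<open>
  Two neighbouring columns of the same height are traversed along a path and its reverse, so the
  passage enters and leaves at level \<open>0\<close>.
\<close>

lemma pair_right:
  assumes "lev t c A 0 l" "hp3 x t a c' S (i + 2) w" "i + 2 < x" "S \<inter> blk x {i, i + 1} UNIV = {}"
  shows "hp3 x t (a + 2) (2 * c + c') (blk x {i, i + 1} A \<union> S) i w"
proof -
  have 1: "hp3 x t 0 c (blk x {i} A) i (l * x + i)"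
    using lev_column[OF assms(1), of i x] assms(3) by simp
  have 2: "hp3 x t 0 c (blk x {i + 1} A) (l * x + (i + 1)) (i + 1)"
    using lev_column[OF lev_rev[OF assms(1)], of "i + 1" x] assms(3) by simp
  have 12: "hp3 x t (Suc (0 + 0)) (c + c) (blk x {i} A \<union> blk x {i + 1} A) i (i + 1)"
    by (rule hp3_append[OF 1 2]) (auto simp: blk_def linear_length_eq)
  have "hp3 x t (Suc (Suc (0 + 0) + a)) (c + c + c') (blk x {i} A \<union> blk x {i + 1} A \<union> S) i w"
    by (rule hp3_append[OF 12 assms(2)]) (use assms(4) in \<open>auto simp: blk_def linear_length_eq\<close>)
  moreover have "blk x {i} A \<union> blk x {i + 1} A = blk x {i, i + 1} A" by (auto simp: blk_def)
  ultimately show ?thesis by (simp add: mult_2)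
qed

lemma pair_left:
  assumes "lev t c A 0 l" "hp3 x t a c' S i w" "i + 2 < x" "S \<inter> blk x {i + 1, i + 2} UNIV = {}"
  shows "hp3 x t (a + 2) (2 * c + c') (blk x {i + 1, i + 2} A \<union> S) (i + 2) w"
proof -
  have 1: "hp3 x t 0 c (blk x {i + 2} A) (i + 2) (l * x + (i + 2))"
    using lev_column[OF assms(1), of "i + 2" x] assms(3) by simp
  have 2: "hp3 x t 0 c (blk x {i + 1} A) (l * x + (i + 1)) (i + 1)"
    using lev_column[OF lev_rev[OF assms(1)], of "i + 1" x] assms(3) by simp
  have 12: "hp3 x t (Suc (0 + 0)) (c + c) (blk x {i + 2} A \<union> blk x {i + 1} A) (i + 2) (i + 1)"
    by (rule hp3_append[OF 1 2]) (auto simp: blk_def linear_length_eq)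
  have "hp3 x t (Suc (Suc (0 + 0) + a)) (c + c + c') (blk x {i + 2} A \<union> blk x {i + 1} A \<union> S) (i + 2) w"
    by (rule hp3_append[OF 12 assms(2)]) (use assms(4) in \<open>auto simp: blk_def linear_length_eq\<close>)
  moreover have "blk x {i + 2} A \<union> blk x {i + 1} A = blk x {i + 1, i + 2} A" by (auto simp: blk_def)
  ultimately show ?thesis by (simp add: mult_2)
qed

text \<open>Both columns of a pair carry the same number of long edges, so only even totals
  \<open>2 * C\<close> are added. They are distributed greedily, at most \<open>K\<close> per
  column.\<close>

lemma pairs_right:
  assumes "\<And>c. c \<le> K \<Longrightarrow> \<exists>l. lev t c A 0 l"
  shows "hp3 x t a c' S (i + 2 * m) w \<Longrightarrow> i + 2 * m < x \<Longrightarrow> C \<le> m * K \<Longrightarrow>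
    S \<inter> blk x {i..<i + 2 * m} UNIV = {} \<Longrightarrow>
    hp3 x t (a + 2 * m) (c' + 2 * C) (blk x {i..<i + 2 * m} A \<union> S) i w"
proof (induction m arbitrary: i C)
  case 0
  then show ?case by (simp add: blk_def)
next
  case (Suc m)
  define C0 where "C0 = min C K"
  have C: "C - C0 \<le> m * K" "C0 \<le> K" "C0 \<le> C" using Suc.prems(3) by (auto simp: C0_def)
  obtain l where l: "lev t C0 A 0 l" using assms C(2) by blast
  have "hp3 x t (a + 2 * m) (c' + 2 * (C - C0)) (blk x {i + 2..<i + 2 + 2 * m} A \<union> S) (i + 2) w"
    by (rule Suc.IH) (use Suc.prems C in \<open>auto simp: blk_def\<close>)
  from pair_right[OF l this]
  have "hp3 x t (a + 2 * m + 2) (2 * C0 + (c' + 2 * (C - C0)))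
    (blk x {i, i + 1} A \<union> (blk x {i + 2..<i + 2 + 2 * m} A \<union> S)) i w"
    using Suc.prems(2,4) by (fastforce simp: blk_def)
  moreover have "blk x {i, i + 1} A \<union> (blk x {i + 2..<i + 2 + 2 * m} A \<union> S)
    = blk x {i..<i + 2 * Suc m} A \<union> S"
    by (auto simp: blk_def)
  ultimately show ?case using C by (simp add: algebra_simps)
qed

lemma pairs_left:
  assumes "\<And>c. c \<le> K \<Longrightarrow> \<exists>l. lev t c A 0 l"
  shows "hp3 x t a c' S i w \<Longrightarrow> i + 2 * m < x \<Longrightarrow> C \<le> m * K \<Longrightarrow>
    S \<inter> blk x {i<..i + 2 * m} UNIV = {} \<Longrightarrow>
    hp3 x t (a + 2 * m) (c' + 2 * C) (blk x {i<..i + 2 * m} A \<union> S) (i + 2 * m) w"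
proof (induction m arbitrary: C)
  case 0
  then show ?case by (simp add: blk_def)
next
  case (Suc m)
  define C0 where "C0 = min C K"
  have C: "C - C0 \<le> m * K" "C0 \<le> K" "C0 \<le> C" using Suc.prems(3) by (auto simp: C0_def)
  obtain l where l: "lev t C0 A 0 l" using assms C(2) by blast
  have "hp3 x t (a + 2 * m) (c' + 2 * (C - C0)) (blk x {i<..i + 2 * m} A \<union> S) (i + 2 * m) w"
    by (rule Suc.IH) (use Suc.prems C in \<open>auto simp: blk_def\<close>)
  from pair_left[OF l this]
  have "hp3 x t (a + 2 * m + 2) (2 * C0 + (c' + 2 * (C - C0)))
    (blk x {i + 2 * m + 1, i + 2 * m + 2} A \<union> (blk x {i<..i + 2 * m} A \<union> S)) (i + 2 * m + 2) w"
    using Suc.prems(2,4) by (fastforce simp: blk_def)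
  moreover have "blk x {i + 2 * m + 1, i + 2 * m + 2} A \<union> (blk x {i<..i + 2 * m} A \<union> S)
    = blk x {i<..i + 2 * Suc m} A \<union> S"
    by (auto simp: blk_def)
  ultimately show ?case using C by (simp add: algebra_simps)
qed

text \<open>
  From the top of column \<open>0\<close> an edge of length \<open>1\<close> leads to column \<open>x - 1\<close>, one level lower.
\<close>

lemma left_frame:
  assumes P: "lev t c0 {..<Suc n} 0 (Suc l)" and Q: "lev t c1 {..<n} 0 l"
    and K: "\<And>c. c \<le> K \<Longrightarrow> \<exists>l. lev t c {..<n} 0 l" and C: "C \<le> m * K"
    and x: "x = e + 2 * m + 2" and "0 < e"
    and S: "hp3 x t a c' S e w" "S \<subseteq> blk x {1..e} UNIV"
  shows "hp3 x t (a + 2 * m + 2) (c0 + c1 + 2 * C + c')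
    (blk x {0} {..<Suc n} \<union> blk x {e<..<x} {..<n} \<union> S) 0 w"
proof -
  have 1: "hp3 x t (a + 2 * m) (c' + 2 * C) (blk x {e<..e + 2 * m} {..<n} \<union> S) (e + 2 * m) w"
    by (rule pairs_left[OF K S(1)]) (use S(2) x C in \<open>auto simp: blk_def\<close>)
  have 2: "hp3 x t 0 c0 (blk x {0} {..<Suc n}) 0 (Suc l * x)"
    using lev_column[OF P, of 0 x] x by simp
  have 3: "hp3 x t 0 c1 (blk x {x - 1} {..<n}) (l * x + (x - 1)) (x - 1)"
    using lev_column[OF lev_rev[OF Q], of "x - 1" x] x by simp
  have 4: "hp3 x t (Suc (0 + 0)) (c0 + c1) (blk x {0} {..<Suc n} \<union> blk x {x - 1} {..<n}) 0 (x - 1)"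
    by (rule hp3_append[OF 2 3]) (use x in \<open>auto simp: blk_def linear_length_eq\<close>)
  have 5: "hp3 x t (Suc (Suc (0 + 0) + (a + 2 * m))) (c0 + c1 + (c' + 2 * C))
      ((blk x {0} {..<Suc n} \<union> blk x {x - 1} {..<n}) \<union> (blk x {e<..e + 2 * m} {..<n} \<union> S)) 0 w"
    by (rule hp3_append[OF 4 1]) (use x S(2) \<open>0 < e\<close> in \<open>fastforce simp: blk_def linear_length_eq\<close>)+
  have "(blk x {0} {..<Suc n} \<union> blk x {x - 1} {..<n}) \<union> (blk x {e<..e + 2 * m} {..<n} \<union> S)
     = blk x {0} {..<Suc n} \<union> blk x {e<..<x} {..<n} \<union> S"
  proof -
    have "{e<..<x} = insert (x - 1) {e<..e + 2 * m}" using x by auto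
    then show ?thesis by (auto simp: blk_def)
  qed
  with 5 show ?thesis by (simp add: algebra_simps)
qed

lemma lev_prepend_lessThan:
  assumes "lev t c {..<n} 0 l"
  shows "lev t c {..<Suc n} 0 (Suc l)"
  using lev_prepend[OF assms] by (simp add: lessThan_Suc_eq_insert_0)

section \<open>Vertex sets compared by level and column\<close>

lemma set_eq_div_modI:
  fixes x :: nat
  assumes "0 < x" "\<And>d m. m < x \<Longrightarrow> d * x + m \<in> S \<longleftrightarrow> d * x + m \<in> T"
  shows "S = T"
proof (rule set_eqI)
  fix y
  show "y \<in> S \<longleftrightarrow> y \<in> T" using assms(2)[of "y mod x" "y div x"] assms(1) by simp
qed

lemma mem_blk: "m < x \<Longrightarrow> d * x + m \<in> blk x J A \<longleftrightarrow> m \<in> J \<and> d \<in> A"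
  by (simp add: blk_def)

lemma div_mod_less_iff:
  fixes x :: nat
  assumes "m < x" "r \<le> x"
  shows "d * x + m < n * x + r \<longleftrightarrow> d < n \<or> d = n \<and> m < r"
proof (cases d n rule: linorder_cases)
  case less
  then have "Suc d * x \<le> n * x" by (intro mult_le_mono1) simp
  then have "d * x + x \<le> n * x" by simp
  then show ?thesis using less assms by linarith
next
  case greater
  then have "Suc n * x \<le> d * x" by (intro mult_le_mono1) simp
  then have "n * x + x \<le> d * x" by simp
  then show ?thesis using greater assms by linarith
qed auto

lemma div_mod_eq_iff:
  fixes x :: nat
  assumes "m < x" "j < x"
  shows "d * x + m = g * x + j \<longleftrightarrow> d = g \<and> m = j"
proof
  assume "d * x + m = g * x + j"
  then have "(d * x + m) div x = (g * x + j) div x" "(d * x + m) mod x = (g * x + j) mod x" by simp_all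
  then show "d = g \<and> m = j" using assms by simp
qed simp

subsection \<open>Paths inside one column\<close>

text \<open>Stopping one edge before the end makes the data serve twice: they give a path through
  all levels that ends at \<open>l\<close>, and one that avoids \<open>l\<close>, as a split column
  needs. The last edge, of length \<open>t\<close>, is not counted in \<open>c\<close>.\<close>

definition ends_long :: "nat \<Rightarrow> nat \<Rightarrow> nat \<Rightarrow> nat \<Rightarrow> bool" where
  "ends_long t c N l \<longleftrightarrow>
    l < N \<and> (\<exists>l'. lev t c ({..<N} - {l}) 0 l' \<and> linear_length l' l = t)"

lemma ends_long_lev:
  assumes "ends_long t c N l"
  shows "lev t (Suc c) {..<N} 0 l"
proof -
  obtain l' where l': "lev t c ({..<N} - {l}) 0 l'" "linear_length l' l = t" "l < N"
    using assms unfolding ends_long_def by blast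
  have "lev t (Suc (c + 0)) (({..<N} - {l}) \<union> {l}) 0 l"
    by (rule lev_append_long[OF l'(1) lev_single]) (use l' in auto)
  moreover have "({..<N} - {l}) \<union> {l} = {..<N}" using l'(3) by auto
  ultimately show ?thesis by simp
qed

lemma lev_prepend_hole:
  assumes "lev t c ({..<N} - {l}) 0 w"
  shows "lev t c ({..<Suc N} - {Suc l}) 0 (Suc w)"
proof -
  have "insert 0 (Suc ` ({..<N} - {l})) = {..<Suc N} - {Suc l}"
    by (auto simp: lessThan_Suc_eq_insert_0)
  then show ?thesis using lev_prepend[OF assms] by simp
qed

lemma ends_long_Suc: "ends_long t c N l \<Longrightarrow> ends_long t c (Suc N) (Suc l)"
  unfolding ends_long_def using lev_prepend_hole
  by (metis Suc_less_eq diff_Suc_Suc linear_length_eq Suc_le_mono)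

lemma ends_long_mono: "N \<le> N' \<Longrightarrow> ends_long t c N l \<Longrightarrow> \<exists>l. ends_long t c N' l"
  by (induction N' rule: dec_induct) (auto intro: ends_long_Suc)

lemma lev_mono: "N \<le> N' \<Longrightarrow> lev t c {..<N} 0 l \<Longrightarrow> \<exists>l. lev t c {..<N'} 0 l"
  by (induction N' rule: dec_induct) (auto intro: lev_prepend_lessThan)

section \<open>Snakes through the residue classes modulo t\<close>

lemma column_up: "0 < g \<Longrightarrow> j < x \<Longrightarrow> hp3 x s 0 0 (blk x {j} {..<g}) j ((g - 1) * x + j)"
  using lev_column[OF lev_up, of g j x s] by simp

lemma monotone_column: "0 < h \<Longrightarrow> c \<le> 0 \<Longrightarrow> \<exists>l. lev t c {..<h} 0 l"
  using lev_up by auto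

text \<open>Columns are taken two at a time and each pair has one height, so the drop in height at
  \<open>r\<close> must fall between two pairs; hence the parity assumptions.\<close>

lemma snake_right:
  assumes S: "hp3 t s a 0 S e w" "S \<subseteq> blk t {e..<t} UNIV"
    and "r \<le> e" "even r" "even e" "e < t" "0 < k"
  shows "hp3 t s (a + e) 0 (blk t {..<r} {..<Suc k} \<union> blk t {r..<e} {..<k} \<union> S) 0 w"
proof -
  obtain m where m: "r = 2 * m" using assms by (auto elim: evenE)
  obtain m' where m': "e = 2 * m'" using assms by (auto elim: evenE)
  have e: "e = r + 2 * (m' - m)" using m m' assms by simp
  have 1: "hp3 t s (a + 2 * (m' - m)) (0 + 2 * 0) (blk t {r..<r + 2 * (m' - m)} {..<k} \<union> S) r w"
    by (rule pairs_right[OF monotone_column]) (use assms e in \<open>auto simp: blk_def\<close>)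
  have "hp3 t s (a + 2 * (m' - m) + 2 * m) (0 + 2 * 0 + 2 * 0)
    (blk t {0..<0 + 2 * m} {..<Suc k} \<union> (blk t {r..<r + 2 * (m' - m)} {..<k} \<union> S)) 0 w"
    by (rule pairs_right[OF monotone_column]) (use 1 assms m e in \<open>auto simp: blk_def\<close>)
  then show ?thesis using e m by (simp add: Un_assoc lessThan_atLeast0 ac_simps)
qed

text \<open>Leftwards, column \<open>0\<close> of height \<open>k + 1\<close> is coupled with column
  \<open>t - 1\<close> of height \<open>k\<close>. This unequal couple shifts the parity and covers
  the cases where the drop in height would cut a pair.\<close>

lemma snake_left:
  assumes S: "hp3 t s a 0 S e' w" "S \<subseteq> blk t {1..e'} UNIV"
    and "0 < e'" "e' \<le> e" "even (e - e')" "e < t - 1" "even (t - e)" "0 < k"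
  shows "hp3 t s (a + (t - e')) 0
    (blk t {0} {..<Suc k} \<union> blk t {e<..<t} {..<k} \<union> (blk t {e'<..e} {..<Suc k} \<union> S)) 0 w"
proof -
  obtain m where m: "e - e' = 2 * m" using \<open>even (e - e')\<close> by (rule evenE)
  obtain m' where m': "t - e = 2 * m'" using \<open>even (t - e)\<close> by (rule evenE)
  have m'0: "m' > 0" using m' assms by (cases m') auto
  have t: "t = e + 2 * (m' - 1) + 2" and e: "e = e' + 2 * m" using m m' m'0 assms by simp_all
  have 1: "hp3 t s (a + 2 * m) (0 + 2 * 0) (blk t {e'<..e' + 2 * m} {..<Suc k} \<union> S) (e' + 2 * m) w"
    by (rule pairs_left[OF monotone_column S(1)]) (use assms e in \<open>auto simp: blk_def\<close>)
  have P: "lev s 0 {..<Suc k} 0 (Suc (k - 1))" "lev s 0 {..<k} 0 (k - 1)"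
    using lev_up[of "Suc k"] lev_up[of k] \<open>0 < k\<close> by auto
  have "hp3 t s (a + 2 * m + 2 * (m' - 1) + 2) (0 + 0 + 2 * 0 + 0)
    (blk t {0} {..<Suc k} \<union> blk t {e<..<t} {..<k} \<union> (blk t {e'<..e} {..<Suc k} \<union> S)) 0 w"
    by (rule left_frame[OF P monotone_column, where C = 0])
      (use 1 S(2) t e \<open>0 < k\<close> \<open>0 < e'\<close> in \<open>auto simp: blk_def\<close>)
  moreover have "a + 2 * m + 2 * (m' - 1) + 2 = a + (t - e')" using t e by simp
  ultimately show ?thesis by (simp only: add_0_right mult_0_right)
qed

lemma two_columns_down:
  assumes "1 < h" "i < x" "j < x" "linear_length i j = 1"
  shows "hp3 x s 1 0 (blk x {i} {..<h} \<union> blk x {j} {1..<h}) i (x + j)"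
proof -
  have 1: "hp3 x s 0 0 (blk x {i} {..<h}) i ((h - 1) * x + i)"
    by (rule column_up) (use assms in auto)
  have "lev s 0 {1..h - 1} (h - 1) 1" by (rule lev_run_down) (use assms in auto)
  moreover have "{1..h - 1} = {1..<h}" using assms by auto
  ultimately have 2: "hp3 x s 0 0 (blk x {j} {1..<h}) ((h - 1) * x + j) (1 * x + j)"
    using lev_column[of s 0 "{1..<h}" "h - 1" 1 j x] assms by simp
  have "i \<noteq> j" using assms(4) by (auto simp: linear_length_eq)
  then have "blk x {i} {..<h} \<inter> blk x {j} {1..<h} = {}" by (auto simp: blk_def)
  moreover have "linear_length ((h - 1) * x + i) ((h - 1) * x + j) = 1"
    using assms(4) by (auto simp: linear_length_eq split: if_splits)
  ultimately show ?thesis using hp3_append[OF 1 2] by simp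
qed

text \<open>Column \<open>2\<close> is visited twice, above \<open>g - 1\<close> on the way to
  column \<open>1\<close> and up to \<open>f\<close> afterwards. This costs a third edge of length
  \<open>1\<close>, and a gap between \<open>f\<close> and \<open>g - 1\<close> leaves room for a
  hole.\<close>

lemma three_columns:
  assumes "3 < x" "0 < g" "g \<le> h" "f < g - 1"
  shows "hp3 x s 3 0 (blk x {3} {..<h} \<union> blk x {2} {g - 1..<h} \<union> blk x {1} {..<g} \<union> blk x {2} {..f})
    3 (f * x + 2)"
proof -
  have 1: "hp3 x s 0 0 (blk x {3} {..<h}) 3 ((h - 1) * x + 3)"
    by (rule column_up) (use assms in auto)
  have h: "{g - 1..<h} = {g - 1..h - 1}" using assms by auto
  have "lev s 0 {g - 1..h - 1} (h - 1) (g - 1)" by (rule lev_run_down) (use assms in auto)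
  from lev_column[OF this, of 2 x]
  have 2: "hp3 x s 0 0 (blk x {2} {g - 1..<h}) ((h - 1) * x + 2) ((g - 1) * x + 2)"
    using assms h by simp
  have 3: "hp3 x s 0 0 (blk x {1} {..<g}) ((g - 1) * x + 1) 1"
    by (rule hp3_rev[OF column_up]) (use assms in auto)
  have "lev s 0 {0..f} 0 f" by (rule lev_run) simp
  from lev_column[OF this, of 2 x]
  have 4: "hp3 x s 0 0 (blk x {2} {..f}) 2 (f * x + 2)"
    using assms by (simp add: atLeast0AtMost numeral_2_eq_2)
  have 12: "hp3 x s (Suc (0 + 0)) (0 + 0) (blk x {3} {..<h} \<union> blk x {2} {g - 1..<h}) 3 ((g - 1) * x + 2)"
    by (rule hp3_append[OF 1 2]) (auto simp: blk_def linear_length_eq)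
  have 123: "hp3 x s (Suc (Suc (0 + 0) + 0)) (0 + 0 + 0)
      (blk x {3} {..<h} \<union> blk x {2} {g - 1..<h} \<union> blk x {1} {..<g}) 3 1"
    by (rule hp3_append[OF 12 3]) (auto simp: blk_def linear_length_eq)
  have "hp3 x s (Suc (Suc (Suc (0 + 0) + 0) + 0)) (0 + 0 + 0 + 0)
      (blk x {3} {..<h} \<union> blk x {2} {g - 1..<h} \<union> blk x {1} {..<g} \<union> blk x {2} {..f}) 3 (f * x + 2)"
    by (rule hp3_append[OF 123 4]) (use assms in \<open>auto simp: blk_def linear_length_eq\<close>)
  then show ?thesis by (simp add: numeral_3_eq_3)
qed


lemma lev_snakeI:
  assumes "hp3 t s a 0 S 0 l'" "l = g * t + j" "j < t"
    "N = k * t + r" "r \<le> t" "l < N" "a + c + 2 = N"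
    "\<And>d m. m < t \<Longrightarrow> d * t + m \<in> S \<longleftrightarrow> (d < k \<or> d = k \<and> m < r) \<and> \<not> (d = g \<and> m = j)"
  shows "lev t c ({..<N} - {l}) 0 l'"
proof -
  have S: "S = {..<N} - {l}"
    by (rule set_eq_div_modI[of t])
      (use assms in \<open>auto simp: div_mod_less_iff div_mod_eq_iff simp del: mult_Suc\<close>)
  then have "card S = N - 1" using assms(6) by simp
  from hp3_lev[OF assms(1) this] S show ?thesis using assms(7) by auto
qed

lemma ends_long_snakeI:
  assumes "hp3 t s a 0 S 0 l'" "l' = g' * t + j" "l = g * t + j" "j < t" "g' = Suc g \<or> g = Suc g'"
    "N = k * t + r" "r \<le> t" "l < N" "a + c + 2 = N"
    "\<And>d m. m < t \<Longrightarrow> d * t + m \<in> S \<longleftrightarrow> (d < k \<or> d = k \<and> m < r) \<and> \<not> (d = g \<and> m = j)"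
  shows "ends_long t c N l"
  unfolding ends_long_def
  using lev_snakeI[OF assms(1,3,4,6-10)] assms(2,3,5,8)
  by (intro conjI exI[of _ l']) (auto simp: linear_length_eq)

lemma snake_end_bound: "1 < k \<Longrightarrow> t + t \<le> k * (t::nat)"
  using mult_le_mono1[of 2 k t] by (simp add: mult_2)

text \<open>The last two columns are climbed and descended, so the vertex left for the end is the
  bottom \<open>t - 1\<close> of the last column, reached from level \<open>1\<close>.\<close>

lemma ends_long_even_even:
  assumes "even t" "even r" "r < t" "1 < k"
  shows "\<exists>l. ends_long t (k * t + r - t - 1) (k * t + r) l"
proof -
  have t: "t \<ge> 2" "r \<le> t - 2" using assms by presburger+
  have B: "hp3 t 0 1 0 (blk t {t - 2} {..<k} \<union> blk t {t - 1} {1..<k}) (t - 2) (t + (t - 1))"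
    by (rule two_columns_down) (use t assms in \<open>auto simp: linear_length_eq\<close>)
  have "hp3 t 0 (1 + (t - 2)) 0 (blk t {..<r} {..<Suc k} \<union> blk t {r..<t - 2} {..<k} \<union>
      (blk t {t - 2} {..<k} \<union> blk t {t - 1} {1..<k})) 0 (t + (t - 1))"
    by (rule snake_right[OF B]) (use t assms in \<open>auto simp: blk_def\<close>)
  then have "ends_long t (k * t + r - t - 1) (k * t + r) (0 * t + (t - 1))"
    by (rule ends_long_snakeI[where g' = "1" and g = "0" and j = "t - 1" and k = k and r = r])
      (use t assms snake_end_bound[OF \<open>1 < k\<close>, of t] in \<open>auto simp: mem_blk\<close>)
  then show ?thesis ..
qed

lemma ends_long_even_odd:
  assumes "even t" "odd r" "r < t" "1 < k"
  shows "\<exists>l. ends_long t (k * t + r - t - 1) (k * t + r) l"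
proof (cases "t = 2")
  case True
  then have r: "r = 1" using assms by presburger
  have 1: "hp3 2 0 0 0 (blk 2 {0} {..<Suc k}) 0 ((Suc k - 1) * 2 + 0)"
    by (rule column_up) auto
  have "lev 0 0 {1..k - 1} (k - 1) 1" by (rule lev_run_down) (use assms in auto)
  from lev_column[OF this, of 1 2]
  have 2: "hp3 2 0 0 0 (blk 2 {1} {1..k - 1}) ((k - 1) * 2 + 1) (1 * 2 + 1)" by simp
  have "hp3 2 0 (Suc (0 + 0)) (0 + 0) (blk 2 {0} {..<Suc k} \<union> blk 2 {1} {1..k - 1}) 0 (1 * 2 + 1)"
    by (rule hp3_append[OF 1 2]) (use assms in \<open>auto simp: blk_def linear_length_eq\<close>)
  then have "ends_long t (k * t + r - t - 1) (k * t + r) (0 * t + 1)"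
    unfolding True add_0_right by (rule ends_long_snakeI[where g' = "1" and g = "0" and j = "1" and k = k and r = r])
      (use r assms in \<open>auto simp: mem_blk\<close>)
  then show ?thesis ..
next
  case False
  then have t: "t \<ge> 4" using assms by presburger
  \<comment> \<open>For \<open>r = 1\<close> columns \<open>1\<close> and \<open>2\<close> are among
    those of height \<open>k\<close>; the boundary \<open>r - 1\<close> is then moved past
    them.\<close>
  define e where "e = (if r = 1 then 2 else r - 1)"
  define h where "h = (if r = 1 then k else Suc k)"
  have r: "r = 1 \<or> r \<ge> 3" using assms by presburger
  have e: "2 \<le> e" "e < t - 1" "even e" using r assms t by (auto simp: e_def)
  have B: "hp3 t 0 1 0 (blk t {2} {..<h} \<union> blk t {1} {1..<h}) 2 (t + 1)"
    by (rule two_columns_down) (use t assms in \<open>auto simp: linear_length_eq h_def\<close>)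
  have "hp3 t 0 (1 + (t - 2)) 0 (blk t {0} {..<Suc k} \<union> blk t {e<..<t} {..<k} \<union>
      (blk t {2<..e} {..<Suc k} \<union> (blk t {2} {..<h} \<union> blk t {1} {1..<h}))) 0 (t + 1)"
    by (rule snake_left[OF B]) (use t assms e in \<open>auto simp: blk_def\<close>)
  then have "ends_long t (k * t + r - t - 1) (k * t + r) (0 * t + 1)"
  proof (rule ends_long_snakeI[where g' = "1" and g = "0" and j = "1" and k = k and r = r])
    show "(d * t + m \<in> blk t {0} {..<Suc k} \<union> blk t {e<..<t} {..<k} \<union>
      (blk t {2<..e} {..<Suc k} \<union> (blk t {2} {..<h} \<union> blk t {1} {1..<h}))) =
      ((d < k \<or> d = k \<and> m < r) \<and> \<not> (d = 0 \<and> m = 1))" if "m < t" for d m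
      unfolding mem_blk[OF that] Un_iff using that r t assms
      by (auto simp: mem_blk e_def h_def split: if_splits)
  qed (use t assms snake_end_bound[OF \<open>1 < k\<close>, of t] in auto)
  then show ?thesis ..
qed

text \<open>The \<open>t - r\<close> lower columns are odd in number, one being coupled with column
  \<open>0\<close>; columns \<open>r - 1\<close> down to \<open>2\<close> pair up, and column
  \<open>1\<close> is climbed last, its top \<open>k * t + 1\<close> being the end.\<close>

lemma left_odd:
  assumes "odd t" "even r" "2 \<le> r" "r < t" "1 < k"
  shows "ends_long t (k * t + r - t - 1) (k * t + r) (k * t + 1)"
proof -
  have B: "hp3 t 0 0 0 (blk t {1} {..<k}) 1 ((k - 1) * t + 1)"
    by (rule column_up) (use assms in auto)
  have "hp3 t 0 (0 + (t - 1)) 0 (blk t {0} {..<Suc k} \<union> blk t {r - 1<..<t} {..<k} \<union>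
      (blk t {1<..r - 1} {..<Suc k} \<union> blk t {1} {..<k})) 0 ((k - 1) * t + 1)"
    by (rule snake_left[OF B]) (use assms in \<open>auto simp: blk_def\<close>)
  then show ?thesis
    by (rule ends_long_snakeI[where g' = "k - 1" and g = "k" and j = "1" and k = k and r = r])
      (use assms snake_end_bound[OF \<open>1 < k\<close>, of t] in \<open>auto simp: mem_blk\<close>)
qed

lemma left_odd_one:
  assumes "odd t" "1 < t" "1 < k"
  shows "\<exists>l. ends_long t (k * t + 1 - t - 1) (k * t + 1) l"
proof -
  have t: "t \<ge> 3" using assms by presburger
  have B: "hp3 t 0 0 0 (blk t {1} {..<k - 1}) 1 ((k - 1 - 1) * t + 1)"
    by (rule column_up) (use assms in auto)
  have "hp3 t 0 (0 + (t - 1)) 0 (blk t {0} {..<Suc k} \<union> blk t {1<..<t} {..<k} \<union>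
      (blk t {1<..1} {..<Suc k} \<union> blk t {1} {..<k - 1})) 0 ((k - 1 - 1) * t + 1)"
    by (rule snake_left[OF B]) (use t assms in \<open>auto simp: blk_def\<close>)
  then have "ends_long t (k * t + 1 - t - 1) (k * t + 1) ((k - 1) * t + 1)"
    by (rule ends_long_snakeI[where g' = "k - 1 - 1" and g = "k - 1" and j = "1" and k = k and r = 1])
      (use t assms snake_end_bound[OF \<open>1 < k\<close>, of t] in \<open>auto simp: mem_blk\<close>)
  then show ?thesis ..
qed

text \<open>This ends at the top of the last column. Having ends at both \<open>k * t - 1\<close>
  and \<open>k * t + 1\<close> allows two columns of different heights to be joined at the right
  level in \<open>realization_one\<close>.\<close>

lemma right_odd:
  assumes "odd t" "even r" "r < t" "1 < k"
  shows "ends_long t (k * t + r - t - 1) (k * t + r) (k * t - 1)"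
proof -
  have B: "hp3 t 0 0 0 (blk t {t - 1} {..<k - 1}) (t - 1) ((k - 1 - 1) * t + (t - 1))"
    by (rule column_up) (use assms in auto)
  have "hp3 t 0 (0 + (t - 1)) 0 (blk t {..<r} {..<Suc k} \<union> blk t {r..<t - 1} {..<k} \<union>
      blk t {t - 1} {..<k - 1}) 0 ((k - 1 - 1) * t + (t - 1))"
    by (rule snake_right[OF B]) (use assms in \<open>auto simp: blk_def\<close>)
  moreover obtain k' where "k = Suc k'" using assms by (cases k) auto
  then have "k * t - 1 = (k - 1) * t + (t - 1)" using assms by auto
  ultimately show ?thesis
  proof (intro ends_long_snakeI[where g' = "k - 1 - 1" and g = "k - 1" and j = "t - 1" and k = k and r = r])
    show "(d * t + m \<in> blk t {..<r} {..<Suc k} \<union> blk t {r..<t - 1} {..<k} \<union> blk t {t - 1} {..<k - 1}) =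
      ((d < k \<or> d = k \<and> m < r) \<and> \<not> (d = k - 1 \<and> m = t - 1))" if "m < t" for d m
      unfolding mem_blk[OF that] Un_iff using that assms by auto
  qed (use assms snake_end_bound[OF \<open>1 < k\<close>, of t] in auto)
qed



text \<open>One edge of length \<open>t\<close> fewer than the bound allows, but still the last edge
  is long. The hole is level \<open>k - 1\<close> of column \<open>2\<close>, reached from level
  \<open>k - 2\<close>.\<close>

lemma left_odd_twisted:
  assumes "odd t" "even r" "4 \<le> r" "r < t" "1 < k"
  shows "\<exists>l. ends_long t (k * t + r - t - 2) (k * t + r) l"
proof -
  have B: "hp3 t 0 3 0 (blk t {3} {..<Suc k} \<union> blk t {2} {Suc k - 1..<Suc k} \<union> blk t {1} {..<Suc k} \<union>
    blk t {2} {..k - 2}) 3 ((k - 2) * t + 2)"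
    by (rule three_columns) (use assms in auto)
  have "hp3 t 0 (3 + (t - 3)) 0 (blk t {0} {..<Suc k} \<union> blk t {r - 1<..<t} {..<k} \<union>
      (blk t {3<..r - 1} {..<Suc k} \<union> (blk t {3} {..<Suc k} \<union> blk t {2} {Suc k - 1..<Suc k} \<union>
      blk t {1} {..<Suc k} \<union> blk t {2} {..k - 2}))) 0 ((k - 2) * t + 2)"
    by (rule snake_left[OF B]) (use assms in \<open>auto simp: blk_def\<close>)
  then have "ends_long t (k * t + r - t - 2) (k * t + r) ((k - 1) * t + 2)"
  proof (rule ends_long_snakeI[where g' = "k - 2" and g = "k - 1" and j = 2 and k = k and r = r])
    show "(d * t + m \<in> blk t {0} {..<Suc k} \<union> blk t {r - 1<..<t} {..<k} \<union>
      (blk t {3<..r - 1} {..<Suc k} \<union> (blk t {3} {..<Suc k} \<union> blk t {2} {Suc k - 1..<Suc k} \<union>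
      blk t {1} {..<Suc k} \<union> blk t {2} {..k - 2}))) =
      ((d < k \<or> d = k \<and> m < r) \<and> \<not> (d = k - 1 \<and> m = 2))" if "m < t" for d m
    proof -
      consider "m = 0" | "m = 1" | "m = 2" | "m = 3" | "3 < m" by linarith
      then show ?thesis
        unfolding mem_blk[OF that] Un_iff using that \<open>4 \<le> r\<close> \<open>1 < k\<close>
        by cases auto
    qed
    show "(k - 1) * t + 2 < k * t + r"
      using assms by (intro add_le_less_mono mult_le_mono1) auto
  qed (use assms snake_end_bound[OF \<open>1 < k\<close>, of t] in auto)
  then show ?thesis ..
qed

text \<open>
  The set avoided here is the end point of \<open>left_odd\<close>; the path has one edge of length \<open>1\<close> more
  than the one there.
\<close>

lemma left_odd_hole:
  assumes "odd t" "even r" "2 \<le> r" "r < t" "1 < k" "5 \<le> t"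
  shows "\<exists>w. lev t (k * t + r - t - 2) ({..<k * t + r} - {k * t + 1}) 0 w"
proof -
  \<comment> \<open>Column \<open>1\<close> is used only up to level \<open>k - 1\<close>, which
    makes the hole \<open>k * t + 1\<close>. For \<open>r = 2\<close> columns \<open>2\<close> and
    \<open>3\<close> have height \<open>k\<close> as well.\<close>
  define e where "e = (if r = 2 then 3 else r - 1)"
  define h where "h = (if r = 2 then k else Suc k)"
  have r: "r = 2 \<or> 4 \<le> r" using assms by presburger
  have e: "3 \<le> e" "e < t - 1" "odd e" using assms r by (auto simp: e_def)
  have B: "hp3 t 0 3 0 (blk t {3} {..<h} \<union> blk t {2} {k - 1..<h} \<union> blk t {1} {..<k} \<union>
    blk t {2} {..k - 2}) 3 ((k - 2) * t + 2)"
    by (rule three_columns) (use assms in \<open>auto simp: h_def\<close>)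
  have "hp3 t 0 (3 + (t - 3)) 0 (blk t {0} {..<Suc k} \<union> blk t {e<..<t} {..<k} \<union>
      (blk t {3<..e} {..<Suc k} \<union> (blk t {3} {..<h} \<union> blk t {2} {k - 1..<h} \<union>
      blk t {1} {..<k} \<union> blk t {2} {..k - 2}))) 0 ((k - 2) * t + 2)"
    by (rule snake_left[OF B]) (use assms e in \<open>auto simp: blk_def\<close>)
  then have "lev t (k * t + r - t - 2) ({..<k * t + r} - {k * t + 1}) 0 ((k - 2) * t + 2)"
  proof (rule lev_snakeI[where g = k and j = 1 and k = k and r = r])
    show "(d * t + m \<in> blk t {0} {..<Suc k} \<union> blk t {e<..<t} {..<k} \<union>
      (blk t {3<..e} {..<Suc k} \<union> (blk t {3} {..<h} \<union> blk t {2} {k - 1..<h} \<union>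
      blk t {1} {..<k} \<union> blk t {2} {..k - 2}))) =
      ((d < k \<or> d = k \<and> m < r) \<and> \<not> (d = k \<and> m = 1))" if "m < t" for d m
    proof -
      consider "m = 0" | "m = 1" | "m = 2" | "m = 3" | "m > 3" by linarith
      then show ?thesis
        unfolding mem_blk[OF that] Un_iff using that r \<open>1 < k\<close>
        by cases (auto simp: e_def h_def split: if_splits)
    qed
  qed (use assms snake_end_bound[OF \<open>1 < k\<close>, of t] in auto)
  then show ?thesis ..
qed

text \<open>
  For \<open>N \<le> 2 * t\<close> every residue class has at most two elements, and the path
  \<open>0, t, t - 1, \<dots>, j, j - 1, t + j - 1, t + j - 2, j - 2, \<dots>\<close> works regardless of parities.
\<close>

lemma zigzag:
  "2 \<le> j \<Longrightarrow> j \<le> t \<Longrightarrow> \<exists>l l'. lev t (j - 2) (({1..<j} \<union> {t + 1..<t + j}) - {l}) (j - 1) l' \<and>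
    linear_length l' l = t \<and> l \<in> {1..<j} \<union> {t + 1..<t + j}"
proof (induction j rule: less_induct)
  case (less j)
  consider "j = 2" | "j = 3" | "4 \<le> j" using less.prems by linarith
  then show ?case
  proof cases
    case 1
    have "({1..<j} \<union> {t + 1..<t + j}) - {t + 1} = {1}" using 1 less.prems by auto
    then have "lev t (j - 2) (({1..<j} \<union> {t + 1..<t + j}) - {t + 1}) (j - 1) 1"
      using 1 lev_single[of t 1] by simp
    then show ?thesis using 1 by (intro exI[of _ "t + 1"] exI[of _ 1]) (simp add: linear_length_eq)
  next
    case 2
    have "lev t (Suc (0 + 0)) ({2} \<union> {t + 1..t + 2}) 2 (t + 1)"
      by (rule lev_append_long[OF lev_single lev_run_down])
        (use 2 less.prems in \<open>auto simp: linear_length_eq\<close>)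
    moreover have "({1..<j} \<union> {t + 1..<t + j}) - {1} = {2} \<union> {t + 1..t + 2}"
      using 2 less.prems by auto
    ultimately show ?thesis using 2
      by (intro exI[of _ 1] exI[of _ "t + 1"]) (simp add: linear_length_eq)
  next
    case 3
    then have j: "j - 2 < j" "2 \<le> j - 2" "j - 2 \<le> t" using less.prems by auto
    obtain l l' where l: "lev t (j - 2 - 2) (({1..<j - 2} \<union> {t + 1..<t + (j - 2)}) - {l}) (j - 2 - 1) l'"
      "linear_length l' l = t" "l \<in> {1..<j - 2} \<union> {t + 1..<t + (j - 2)}"
      using less.IH[OF j] by blast
    have 1: "lev t (Suc (0 + 0)) ({j - 1} \<union> {t + j - 2..t + j - 1}) (j - 1) (t + j - 2)"
      by (rule lev_append_long[OF lev_single lev_run_down])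
        (use 3 less.prems in \<open>auto simp: linear_length_eq\<close>)
    have 2: "lev t (Suc (Suc (0 + 0) + 0)) ({j - 1} \<union> {t + j - 2..t + j - 1} \<union> {j - 2}) (j - 1) (j - 2)"
      by (rule lev_append_long[OF 1 lev_single])
        (use 3 less.prems in \<open>auto simp: linear_length_eq\<close>)
    have "lev t (Suc (Suc (0 + 0) + 0) + (j - 2 - 2)) ({j - 1} \<union> {t + j - 2..t + j - 1} \<union> {j - 2} \<union>
       (({1..<j - 2} \<union> {t + 1..<t + (j - 2)}) - {l})) (j - 1) l'"
      by (rule lev_append[OF 2 l(1)]) (use 3 less.prems in \<open>auto simp: linear_length_eq\<close>)
    moreover have "{j - 1} \<union> {t + j - 2..t + j - 1} \<union> {j - 2} \<union>
       (({1..<j - 2} \<union> {t + 1..<t + (j - 2)}) - {l}) = ({1..<j} \<union> {t + 1..<t + j}) - {l}"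
      using 3 l(3) less.prems by auto
    moreover have "Suc (Suc (0 + 0) + 0) + (j - 2 - 2) = j - 2" using 3 by simp
    moreover have "l \<in> {1..<j} \<union> {t + 1..<t + j}" using l(3) by auto
    ultimately show ?thesis using l(2) by (metis (no_types, lifting))
  qed
qed

lemma ends_long_small:
  assumes "2 \<le> j" "j \<le> t"
  shows "\<exists>l. ends_long t (j - 1) (t + j) l"
proof -
  obtain l l' where l: "lev t (j - 2) (({1..<j} \<union> {t + 1..<t + j}) - {l}) (j - 1) l'"
    "linear_length l' l = t" "l \<in> {1..<j} \<union> {t + 1..<t + j}"
    using zigzag[OF assms] by blast
  have 1: "lev t (Suc (0 + 0)) ({0} \<union> {j..t}) 0 j"
    by (rule lev_append_long[OF lev_single lev_run_down]) (use assms in \<open>auto simp: linear_length_eq\<close>)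
  have "lev t (Suc (0 + 0) + (j - 2)) ({0} \<union> {j..t} \<union> (({1..<j} \<union> {t + 1..<t + j}) - {l})) 0 l'"
    by (rule lev_append[OF 1 l(1)]) (use assms in \<open>auto simp: linear_length_eq\<close>)
  moreover have "{0} \<union> {j..t} \<union> (({1..<j} \<union> {t + 1..<t + j}) - {l}) = {..<t + j} - {l}"
    using assms l(3) by auto
  moreover have "Suc (0 + 0) + (j - 2) = j - 1" using assms by simp
  moreover have "l < t + j" using l(3) assms by auto
  ultimately have "ends_long t (j - 1) (t + j) l"
    unfolding ends_long_def using l(2) by (metis (no_types, lifting))
  then show ?thesis ..
qed

text \<open>The heights for which the constructions attain the maximum \<open>N - t\<close> of edges
  of length \<open>t\<close>. The excluded residues mirror the odd residues excluded for
  \<open>omega\<close>.\<close>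

definition tight :: "nat \<Rightarrow> nat \<Rightarrow> bool" where
  "tight t N \<longleftrightarrow> even t \<or> N \<le> 2 * t \<or> N mod t = 1 \<or> even (N mod t)"

lemma ends_long_tight:
  assumes "2 \<le> t" "t + 2 \<le> N" "tight t N"
  shows "\<exists>l. ends_long t (N - t - 1) N l"
proof (cases "N \<le> 2 * t")
  case True
  then show ?thesis using ends_long_small[of "N - t" t] assms by simp
next
  case False
  define k r where "k = N div t" and "r = N mod t"
  have N: "N = k * t + r" by (simp add: k_def r_def)
  have r: "r < t" using assms by (simp add: r_def)
  have k: "1 < k"
  proof (rule ccontr)
    assume "\<not> 1 < k"
    then have "k = 0 \<or> k = 1" by auto
    then show False using False N r by auto
  qed
  consider "even t" "even r" | "even t" "odd r" | "odd t" "r = 1" | "odd t" "even r"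
    using assms(3) False by (auto simp: tight_def r_def)
  then have "\<exists>l. ends_long t (k * t + r - t - 1) (k * t + r) l"
  proof cases
    case 1
    then show ?thesis using ends_long_even_even r k by blast
  next
    case 2
    then show ?thesis using ends_long_even_odd r k by blast
  next
    case 3
    then show ?thesis using left_odd_one[of t k] assms(1) k by simp
  next
    case 4
    then show ?thesis using right_odd r k by blast
  qed
  then show ?thesis unfolding N .
qed

text \<open>The residue of \<open>N\<close> is odd and at least \<open>3\<close>, so one level
  higher it is even and at least \<open>4\<close>, as the twisted snake requires.\<close>

lemma ends_long_twisted:
  assumes "2 \<le> t" "\<not> tight t N"
  shows "\<exists>l. ends_long t (N - t - 1) (Suc N) l"
proof -
  define k r where "k = N div t" and "r = N mod t"
  have N: "N = k * t + r" by (simp add: k_def r_def)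
  have r: "r < t" using assms by (simp add: r_def)
  have t: "odd t" "odd r" "r \<noteq> 1" "2 * t < N" using assms(2) by (auto simp: tight_def r_def)
  have k: "1 < k"
  proof (rule ccontr)
    assume "\<not> 1 < k"
    then have "k = 0 \<or> k = 1" by auto
    then show False using t N r by auto
  qed
  have "even (Suc r)" "4 \<le> Suc r" "Suc r < t" using t r by presburger+
  from left_odd_twisted[OF t(1) this k] show ?thesis
    unfolding N by simp
qed

text \<open>The number \<open>c\<close> is extremal at height \<open>t + c\<close>. A path is built
  there if that height is tight, otherwise one level higher, and then extended by
  prepending.\<close>

lemma ends_long_exists:
  assumes "2 \<le> t" "2 \<le> c" "t + c < N \<or> tight t N \<and> t + c \<le> N"
  shows "\<exists>l. ends_long t (c - 1) N l"
proof (cases "tight t (t + c)")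
  case True
  then obtain l where "ends_long t (c - 1) (t + c) l"
    using ends_long_tight[of t "t + c"] assms by auto
  then show ?thesis using ends_long_mono assms(3) by (metis less_imp_le)
next
  case False
  then have "t + c \<noteq> N" using assms(3) by auto
  moreover obtain l where "ends_long t (c - 1) (Suc (t + c)) l"
    using ends_long_twisted[OF assms(1) False] by auto
  ultimately show ?thesis using ends_long_mono[of "Suc (t + c)" N] assms(3) by auto
qed

lemma lev_exists:
  assumes "2 \<le> t" "0 < N" "t + c < N \<or> c = 0 \<or> tight t N \<and> t + c \<le> N"
  shows "\<exists>l. lev t c {..<N} 0 l"
proof -
  consider "c = 0" | "c = 1" "t + c \<le> N" | "2 \<le> c" "t + c < N \<or> tight t N \<and> t + c \<le> N"
    using assms(3) by linarith
  then show ?thesis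
  proof cases
    case 1
    then show ?thesis using monotone_column[OF assms(2)] by blast
  next
    case 2
    have "lev t (Suc (0 + 0)) ({0} \<union> {1..t}) 0 1"
      by (rule lev_append_long[OF lev_single lev_run_down]) (use assms in \<open>auto simp: linear_length_eq\<close>)
    moreover have "{0} \<union> {1..t} = {..<Suc t}" by auto
    ultimately show ?thesis using 2 lev_mono[of "Suc t" N t 1 1] by auto
  next
    case 3
    then obtain l where "ends_long t (c - 1) N l" using ends_long_exists[OF assms(1)] by blast
    from ends_long_lev[OF this] 3 show ?thesis by auto
  qed
qed

lemma lessThan_blk:
  assumes "0 < x" "r \<le> x"
  shows "{..<n * x + r} = blk x {..<r} {..<Suc n} \<union> blk x {r..<x} {..<n}"
  by (rule set_eq_div_modI[OF assms(1)]) (use assms in \<open>auto simp: mem_blk div_mod_less_iff\<close>)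

lemma not_tight_cases:
  assumes "\<not> tight t N" "2 \<le> t"
  obtains k r where "N = k * t + r" "odd t" "odd r" "3 \<le> r" "r + 2 \<le> t" "1 < k"
proof -
  define k r where "k = N div t" and "r = N mod t"
  have N: "N = k * t + r" by (simp add: k_def r_def)
  have r: "r < t" using assms by (simp add: r_def)
  have t: "odd t" "odd r" "r \<noteq> 1" "2 * t < N" using assms(1) by (auto simp: tight_def r_def)
  have "1 < k"
  proof (rule ccontr)
    assume "\<not> 1 < k"
    then have "k = 0 \<or> k = 1" by auto
    then show False using t N r by auto
  qed
  moreover have "3 \<le> r" "r + 2 \<le> t" using t r by presburger+
  ultimately show thesis using that N t by blast
qed

subsection \<open>Three columns with one additional edge of length \<open>1\<close>\<close>

text \<open>
  The columns are visited in the order \<open>3, 2, 1, 2\<close>, the first visit to column \<open>2\<close> being a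
  single vertex.
\<close>

definition trip :: "nat \<Rightarrow> nat \<Rightarrow> nat \<Rightarrow> bool" where
  "trip t N T \<longleftrightarrow> (\<exists>l e c c'. lev t c {..<N} 0 l \<and> lev t c' ({..<N} - {l}) 0 e \<and> T = 2 * c + c')"

lemma trip_columns:
  assumes "trip t N T" "3 < x"
  shows "\<exists>w. hp3 x t 3 T (blk x {1..3} {..<N}) 3 w"
proof -
  obtain l e c c' where c: "lev t c {..<N} 0 l" "lev t c' ({..<N} - {l}) 0 e" "T = 2 * c + c'"
    using assms(1) unfolding trip_def by blast
  have l: "l < N" using lev_in[OF c(1)] by simp
  have 1: "hp3 x t 0 c (blk x {3} {..<N}) 3 (l * x + 3)"
    using lev_column[OF c(1), of 3 x] assms(2) by simp
  have 2: "hp3 x t 0 0 (blk x {2} {l}) (l * x + 2) (l * x + 2)"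
    using lev_column[OF lev_single, of 2 x t l] assms(2) by simp
  have 3: "hp3 x t 0 c (blk x {1} {..<N}) (l * x + 1) 1"
    using lev_column[OF lev_rev[OF c(1)], of 1 x] assms(2) by simp
  have 4: "hp3 x t 0 c' (blk x {2} ({..<N} - {l})) 2 (e * x + 2)"
    using lev_column[OF c(2), of 2 x] assms(2) by (simp add: numeral_2_eq_2)
  have 12: "hp3 x t (Suc (0 + 0)) (c + 0) (blk x {3} {..<N} \<union> blk x {2} {l}) 3 (l * x + 2)"
    by (rule hp3_append[OF 1 2]) (auto simp: blk_def linear_length_eq)
  have 123: "hp3 x t (Suc (Suc (0 + 0) + 0)) (c + 0 + c)
      (blk x {3} {..<N} \<union> blk x {2} {l} \<union> blk x {1} {..<N}) 3 1"
    by (rule hp3_append[OF 12 3]) (auto simp: blk_def linear_length_eq)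
  have "hp3 x t (Suc (Suc (Suc (0 + 0) + 0) + 0)) (c + 0 + c + c')
      (blk x {3} {..<N} \<union> blk x {2} {l} \<union> blk x {1} {..<N} \<union> blk x {2} ({..<N} - {l})) 3 (e * x + 2)"
    by (rule hp3_append[OF 123 4]) (auto simp: blk_def linear_length_eq)
  moreover have "blk x {3} {..<N} \<union> blk x {2} {l} \<union> blk x {1} {..<N} \<union> blk x {2} ({..<N} - {l})
    = blk x {1..3} {..<N}"
    using l by (auto simp: blk_def)
  moreover have "Suc (Suc (Suc (0 + 0) + 0) + 0) = 3" "c + 0 + c + c' = T" using c(3) by simp_all
  ultimately show ?thesis by metis
qed

lemma trip_Suc: "trip t N T \<Longrightarrow> trip t (Suc N) T"
  unfolding trip_def using lev_prepend_lessThan lev_prepend_hole by blast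

text \<open>With monotone outer columns the single vertex is the top of column \<open>2\<close>, and
  the rest of that column is an ordinary column of height \<open>n\<close>.\<close>

lemma trip_short:
  assumes "lev t c {..<n} 0 e"
  shows "trip t (Suc n) c"
  unfolding trip_def
proof (intro exI conjI)
  show "lev t 0 {..<Suc n} 0 n" using lev_up[of "Suc n" t] by simp
  show "lev t c ({..<Suc n} - {n}) 0 e" using assms by (simp add: lessThan_Suc)
qed simp

lemma trip_long:
  assumes "ends_long t (j - 1) N l" "0 < j"
  shows "trip t N (3 * j - 1)"
proof -
  obtain e where "lev t (j - 1) ({..<N} - {l}) 0 e" using assms(1) unfolding ends_long_def by blast
  moreover have "lev t j {..<N} 0 l" using ends_long_lev[OF assms(1)] assms(2) by simp
  moreover have "3 * j - 1 = 2 * j + (j - 1)" using assms(2) by simp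
  ultimately show ?thesis unfolding trip_def by blast
qed

text \<open>The total is one less than that of \<open>trip_long\<close> for
  \<open>j = n - t\<close>, so it has the other parity. It is built at height \<open>n\<close>,
  whose residue is even, and then prepended.\<close>

lemma trip_not_tight:
  assumes "2 \<le> t" "\<not> tight t (Suc n)"
  shows "trip t (Suc n) (3 * (n - t) - 2)"
proof -
  obtain k r where k: "Suc n = k * t + r" "odd t" "odd r" "3 \<le> r" "r + 2 \<le> t" "1 < k"
    using not_tight_cases[OF assms(2,1)] .
  have n: "n = k * t + (r - 1)" using k by simp
  have r: "even (r - 1)" "2 \<le> r - 1" "r - 1 < t" using k by auto
  have bound: "t + t \<le> k * t" using snake_end_bound k by blast
  have "ends_long t (k * t + (r - 1) - t - 1) (k * t + (r - 1)) (k * t + 1)"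
    by (rule left_odd) (use k in auto)
  from ends_long_lev[OF this] have "lev t (n - t) {..<n} 0 (k * t + 1)"
    using n k bound by (simp add: Suc_diff_Suc)
  moreover obtain w where "lev t (n - t - 2) ({..<n} - {k * t + 1}) 0 w"
    using left_odd_hole[OF k(2) r k(6)] k(4,5) n by auto
  moreover have "3 * (n - t) - 2 = 2 * (n - t) + (n - t - 2)" using n k bound by simp
  ultimately have "trip t n (3 * (n - t) - 2)" unfolding trip_def by blast
  then show ?thesis by (rule trip_Suc)
qed

lemma tight_small: "2 \<le> t \<Longrightarrow> N \<le> t + 2 \<Longrightarrow> tight t N"
  by (simp add: tight_def)

lemma parity_split:
  fixes c M K :: nat
  assumes "c \<le> 2 * M + K" "0 < K"
  obtains D c' where "c = 2 * D + c'" "D \<le> M" "c' \<le> K"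
proof (cases "c \<le> 2 * M")
  case True
  show thesis by (rule that[of "c div 2" "c mod 2"]) (use True assms in auto)
next
  case False
  show thesis by (rule that[of M "c - 2 * M"]) (use False assms in auto)
qed

text \<open>Here \<open>R\<close> is what the paired columns can hold, with two more if height
  \<open>t + 1 + k\<close> is tight. A trip total of the parity of \<open>c\<close> is sought that
  leaves no more than this.\<close>

lemma trip_select:
  fixes t k R c :: nat
  assumes "2 \<le> t" "even R" "2 * k \<le> R" "c \<le> R + 3 * k + 3"
  obtains T D where "trip t (Suc (t + 1 + k)) T" "c = T + 2 * D"
    "2 * D \<le> R + (if tight t (t + 1 + k) then 2 else 0)"
proof -
  note res = that
  let ?n = "t + 1 + k"
  let ?P = "trip t (Suc ?n)"
  let ?tn = "tight t ?n" and ?ts = "tight t (Suc ?n)"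
  have short: "?P T" if T: "T \<le> k \<or> ?tn \<and> T \<le> k + 1" for T
  proof -
    obtain l where "lev t T {..<?n} 0 l" using lev_exists[of t ?n T] assms(1) T by auto
    then show ?thesis by (rule trip_short)
  qed
  have long: "?P (3 * j - 1)" if j: "2 \<le> j" "j \<le> k + 1 \<or> ?ts \<and> j \<le> k + 2" for j
  proof -
    obtain l where "ends_long t (j - 1) (Suc ?n) l"
      using ends_long_exists[of t j "Suc ?n"] assms(1) j by auto
    then show ?thesis using trip_long j by simp
  qed
  \<comment> \<open>The heights \<open>?n\<close> and \<open>Suc ?n\<close> cannot both fail to be
    tight.\<close>
  have extra: "?P (3 * k + 1)" "?tn" if F: "\<not> ?ts"
  proof -
    show "?P (3 * k + 1)" using trip_not_tight[OF assms(1) F] by simp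
    obtain k' r where k': "Suc ?n = k' * t + r" "odd t" "odd r" "3 \<le> r" "r + 2 \<le> t" "1 < k'"
      using not_tight_cases[OF F assms(1)] .
    then have "?n = (r - 1) + k' * t" by simp
    then have "?n mod t = (r - 1) mod t" by (metis mod_mult_self1 mult.commute)
    then have "?n mod t = r - 1" using k' by simp
    then show ?tn using k' by (simp add: tight_def)
  qed
  have tn: "k \<le> 1 \<Longrightarrow> ?tn" using tight_small[OF assms(1)] by simp
  have R: "k = 0 \<or> 4 \<le> R + (if ?tn then 2 else 0)" using tn assms(3) by (cases "k \<le> 1") auto
  have fin: thesis if "?P T" "T \<le> c" "even (c - T)" "c - T \<le> R + (if ?tn then 2 else 0)" for T
    by (rule res[of T "(c - T) div 2"]) (use that in auto)
  show thesis
  proof (cases "c \<le> 3 * k + 3")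
    case True
    consider "c \<le> 4" "even c" | "c \<le> 5" "odd c" | "c = 6" | "7 \<le> c"
    proof -
      have "c \<le> 4 \<and> even c \<or> c \<le> 5 \<and> odd c \<or> c = 6 \<or> 7 \<le> c" by presburger
      then show ?thesis using that by blast
    qed
    then show thesis
    proof cases
      case 1
      have "c \<le> R + (if ?tn then 2 else 0)"
      proof (cases "k = 0")
        case True
        have "c \<le> 2" using 1 \<open>c \<le> 3 * k + 3\<close> True by presburger
        then show ?thesis using tn True by simp
      qed (use R 1 in auto)
      then show thesis by (intro fin[of 0]) (use 1 short in auto)
    next
      case 2
      have "c - 1 \<le> R + (if ?tn then 2 else 0)"
      proof (cases "k = 0")
        case True
        then show ?thesis using tn \<open>c \<le> 3 * k + 3\<close> by simp
      qed (use R 2 in auto)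
      moreover have "1 \<le> c" using 2 by presburger
      moreover have "?P 1" using short[of 1] tn by (cases "k = 0") auto
      ultimately show thesis by (intro fin[of 1]) (use 2 in auto)
    next
      case 3
      have "k \<noteq> 0" using 3 True by auto
      moreover have "?P 2" using short[of 2] tn \<open>k \<noteq> 0\<close> by (cases "k = 1") auto
      ultimately show thesis by (intro fin[of 2]) (use 3 R in auto)
    next
      case 4
      \<comment> \<open>The largest \<open>j\<close> with \<open>3 * j - 1 \<le> c\<close> leaves
        \<open>0\<close>, \<open>1\<close> or \<open>2\<close>; if it leaves the odd value
        \<open>1\<close>, then \<open>j - 1\<close> leaves \<open>4\<close>.\<close>
      define j where "j = (c + 1) div 3"
      have j: "2 \<le> j" "j \<le> k + 1" "3 * j - 1 \<le> c" "c \<le> 3 * j + 1"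
        using 4 True unfolding j_def by auto
      show thesis
      proof (cases "even (c - (3 * j - 1))")
        case True
        show thesis by (rule fin[OF long[of j]]) (use True j assms(3) 4 in auto)
      next
        case False
        define u where "u = c - (3 * j - 1)"
        have "odd u" "u \<le> 2" using False j unfolding u_def by (blast, linarith)
        then have "u = 1" by presburger
        then have "c = 3 * j" using j unfolding u_def by linarith
        then have "3 \<le> j" "c - (3 * (j - 1) - 1) = 4" using 4 j by auto
        moreover have "4 \<le> R" using j \<open>3 \<le> j\<close> assms(3) by simp
        ultimately show thesis by (intro fin[OF long[of "j - 1"]]) (use j in auto)
      qed
    qed
  next
    case False
    show thesis
    proof (cases "even (c - (3 * k + 2))")
      case True
      show thesis
      proof (cases "k = 0")
        case True
        then have "even c" "c \<le> R + 3" "?tn" using \<open>even (c - (3 * k + 2))\<close> False assms(4) tn by auto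
        moreover have "c \<noteq> R + 3" using \<open>even c\<close> assms(2) by auto
        ultimately show thesis
          by (intro fin[OF short[of 0]]) auto
      next
        case False
        \<comment> \<open>The remainder is at most \<open>R + 1\<close> and even, and
          \<open>R\<close> is even, so it is at most \<open>R\<close>.\<close>
        have "c - (3 * k + 2) \<noteq> R + 1" using True assms(2) by (metis even_plus_one_iff)
        then show thesis using True \<open>\<not> c \<le> 3 * k + 3\<close> assms(4) False
          by (intro fin[OF long[of "k + 1"]]) auto
      qed
    next
      case odd: False
      show thesis
      proof (cases ?ts)
        case True
        have "c \<noteq> 3 * k + 4" using odd by auto
        then have "3 * k + 5 \<le> c" "even (c - (3 * k + 5))"
          using odd False by (auto simp: even_diff_nat)
        then show thesis using assms(4) True by (intro fin[OF long[of "k + 2"]]) auto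
      next
        case F: False
        \<comment> \<open>The remainder may now reach \<open>R + 2\<close>; the tightness of
          \<open>?n\<close> from \<open>extra\<close> provides the missing two.\<close>
        have "even (c - (3 * k + 1))" using odd False by (auto simp: even_diff_nat)
        then show thesis using assms(4) False extra[OF F]
          by (intro fin[of "3 * k + 1"]) auto
      qed
    qed
  qed
qed


subsection \<open>The constructions\<close>

text \<open>The first \<open>e\<close> columns have height \<open>?n + 1\<close> and the others
  \<open>?n\<close>. The \<open>x - 1\<close> first columns form pairs, and the last column is left
  to fix the parity of \<open>c\<close>.\<close>

lemma realization_even:
  assumes "odd x" "even e" "e < x" "2 \<le> t" "c \<le> x * k + e"
  shows "\<exists>w. hp3 x t (x - 1) c {..<(t + 1 + k) * x + e} 0 w"
proof -
  let ?n = "t + 1 + k"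
  \<comment> \<open>For \<open>k = 0\<close> the last column must still be able to hold one long
    edge; its height \<open>t + 1\<close> is tight.\<close>
  define K where "K = max k 1"
  obtain m' where m': "e = 2 * m'" using assms(2) by (rule evenE)
  obtain y where y: "x = 2 * y + 1" using assms(1) by (rule oddE)
  define m where "m = y - m'"
  have x: "x = e + 2 * m + 1" using m' y assms(3) by (simp add: m_def)
  define M where "M = m * k + m' * (k + 1)"
  have "c \<le> 2 * M + K" using assms(5) x m' by (simp add: M_def K_def algebra_simps)
  then obtain D c' where D: "c = 2 * D + c'" "D \<le> M" "c' \<le> K"
    by (rule parity_split) (simp add: K_def)
  define C where "C = min D (m * k)"
  have C: "C \<le> m * k" "C \<le> D" "D - C \<le> m' * (k + 1)" using D(2) by (auto simp: C_def M_def)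
  obtain l where "lev t c' {..<?n} 0 l"
    using lev_exists[of t ?n c'] D(3) assms(4) tight_small[of t ?n]
    by (auto simp: K_def max_def split: if_splits)
  from lev_column[OF this, of "x - 1" x]
  have 1: "hp3 x t 0 c' (blk x {x - 1} {..<?n}) (e + 2 * m) (l * x + (x - 1))"
    using x by simp
  have 2: "hp3 x t (0 + 2 * m) (c' + 2 * C)
      (blk x {e..<e + 2 * m} {..<?n} \<union> blk x {x - 1} {..<?n}) e (l * x + (x - 1))"
    by (rule pairs_right[where K = k]) (use 1 x C lev_exists assms(4) in \<open>auto simp: blk_def\<close>)
  have "hp3 x t (0 + 2 * m + 2 * m') (c' + 2 * C + 2 * (D - C))
      (blk x {0..<0 + 2 * m'} {..<Suc ?n} \<union> (blk x {e..<e + 2 * m} {..<?n} \<union> blk x {x - 1} {..<?n}))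
      0 (l * x + (x - 1))"
    by (rule pairs_right[where K = "k + 1"])
      (use 2 m' x C lev_exists assms(4) in \<open>auto simp: blk_def\<close>)
  moreover have "blk x {0..<0 + 2 * m'} {..<Suc ?n} \<union>
      (blk x {e..<e + 2 * m} {..<?n} \<union> blk x {x - 1} {..<?n}) = {..<?n * x + e}"
  proof -
    have "{e..<x} = insert (x - 1) {e..<e + 2 * m}" using x by auto
    then have "blk x {e..<x} {..<?n} = blk x {e..<e + 2 * m} {..<?n} \<union> blk x {x - 1} {..<?n}"
      by (auto simp: blk_def)
    moreover have "{0..<0 + 2 * m'} = {..<e}" using m' by auto
    ultimately show ?thesis using lessThan_blk[of x e ?n] assms(3) by simp
  qed
  moreover have "0 + 2 * m + 2 * m' = x - 1" "c' + 2 * C + 2 * (D - C) = c" using x m' C D by auto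
  ultimately show ?thesis by metis
qed

lemma realization_one:
  assumes "odd x" "1 < x" "2 \<le> t" "c \<le> x * k + 1"
  shows "\<exists>w. hp3 x t (x - 1) c {..<(t + 1 + k) * x + 1} 0 w"
proof -
  let ?n = "t + 1 + k"
  obtain y where y: "x = 2 * y + 1" using assms(1) by (rule oddE)
  define m where "m = y - 1"
  have x: "x = 1 + 2 * m + 2" using y assms(2) by (simp add: m_def)
  have frame: "\<exists>w. hp3 x t (x - 1) c {..<?n * x + 1} 0 w"
    if P: "lev t c0 {..<Suc ?n} 0 (Suc l)" and Q: "lev t c1 {..<?n} 0 l"
      and K: "\<And>c. c \<le> K \<Longrightarrow> \<exists>l. lev t c {..<?n} 0 l" and C: "C \<le> m * K" "c' \<le> K"
      and c: "c = c0 + c1 + 2 * C + c'" for c0 c1 c' l K C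
  proof -
    obtain w where "lev t c' {..<?n} 0 w" using K C(2) by blast
    from lev_column[OF this, of 1 x]
    have 1: "hp3 x t 0 c' (blk x {1} {..<?n}) 1 (w * x + 1)" using x by simp
    have "hp3 x t (0 + 2 * m + 2) (c0 + c1 + 2 * C + c')
      (blk x {0} {..<Suc ?n} \<union> blk x {1<..<x} {..<?n} \<union> blk x {1} {..<?n}) 0 (w * x + 1)"
      by (rule left_frame[OF P Q K C(1) x _ 1]) (auto simp: blk_def)
    moreover have "blk x {0} {..<Suc ?n} \<union> blk x {1<..<x} {..<?n} \<union> blk x {1} {..<?n} = {..<?n * x + 1}"
    proof -
      have sets: "{..<1::nat} = {0}" "{1..<x} = insert 1 {1<..<x}" using assms(2) by auto
      have "0 < x" "1 \<le> x" using assms(2) by auto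
      show ?thesis unfolding lessThan_blk[OF \<open>0 < x\<close> \<open>1 \<le> x\<close>] sets by (auto simp: blk_def)
    qed
    moreover have "0 + 2 * m + 2 = x - 1" using x by simp
    ultimately show ?thesis using c by metis
  qed
  have split: "\<exists>w. hp3 x t (x - 1) c {..<?n * x + 1} 0 w"
    if K: "\<And>c. c \<le> K \<Longrightarrow> \<exists>l. lev t c {..<?n} 0 l" and "0 < K" "c \<le> x * K" for K
  proof -
    have "x * K = 2 * ((m + 1) * K) + K" using x by (simp add: algebra_simps)
    then obtain D c' where D: "c = 2 * D + c'" "D \<le> (m + 1) * K" "c' \<le> K"
      using parity_split[of c "(m + 1) * K" K] \<open>0 < K\<close> \<open>c \<le> x * K\<close> by metis
    define C where "C = min D (m * K)"
    have C: "C \<le> m * K" "C \<le> D" "D - C \<le> K" using D(2) by (auto simp: C_def)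
    then obtain l where l: "lev t (D - C) {..<?n} 0 l" using K by blast
    show ?thesis
      by (rule frame[OF lev_prepend_lessThan[OF l] l K C(1) D(3)]) (use D C in auto)
  qed
  show ?thesis
  proof (cases "tight t ?n")
    case True
    show ?thesis
      by (rule split[of "k + 1"]) (use lev_exists[of t ?n] True assms in auto)
  next
    case False
    obtain k' r where k': "?n = k' * t + r" "odd t" "odd r" "3 \<le> r" "r + 2 \<le> t" "1 < k'"
      using not_tight_cases[OF False assms(3)] .
    have k: "0 < k" using False tight_small[of t ?n] assms(3) by (cases k) auto
    have K: "\<exists>l. lev t c {..<?n} 0 l" if "c \<le> k" for c
      using lev_exists[of t ?n c] that assms(3) by auto
    show ?thesis
    proof (cases "c \<le> x * k")
      case True
      then show ?thesis using split[OF K k] by blast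
    next
      case c: False
      have bound: "t + t \<le> k' * t" using snake_end_bound k'(6) by blast
      \<comment> \<open>Only \<open>c = x * k + 1\<close> is left. Column \<open>0\<close> takes
        \<open>k + 2\<close> long edges, column \<open>x - 1\<close> and the \<open>2 * m\<close>
        middle columns \<open>k\<close> each, and column \<open>1\<close> takes
        \<open>k - 1\<close>. The paths in columns \<open>0\<close> and \<open>x - 1\<close> must
        end at consecutive levels, here \<open>k' * t + 1\<close> and \<open>k' * t\<close>.\<close>
      have "ends_long t (k' * t + (r + 1) - t - 1) (k' * t + (r + 1)) (k' * t + 1)"
        by (rule left_odd) (use k' in auto)
      moreover have "k' * t + (r + 1) - t - 1 = k + 1" "k' * t + (r + 1) = Suc ?n"
        using k'(1) by simp_all
      ultimately have P: "lev t (k + 2) {..<Suc ?n} 0 (Suc (k' * t))"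
        using ends_long_lev[of t "k + 1" "Suc ?n"] by simp
      have "ends_long t (k' * t + (r - 1) - t - 1) (k' * t + (r - 1)) (k' * t - 1)"
        by (rule right_odd) (use k' in auto)
      from lev_prepend_lessThan[OF ends_long_lev[OF this]]
      have "lev t (Suc (k' * t + (r - 1) - t - 1)) {..<Suc (k' * t + (r - 1))} 0 (Suc (k' * t - 1))" .
      moreover have "Suc (k' * t + (r - 1) - t - 1) = k" "Suc (k' * t + (r - 1)) = ?n"
        "Suc (k' * t - 1) = k' * t"
        using k' bound k by linarith+
      ultimately have Q: "lev t k {..<?n} 0 (k' * t)" by simp
      show ?thesis
        by (rule frame[OF P Q K, where C = "m * k" and c' = "k - 1"])
          (use c assms(4) x k in \<open>auto simp: algebra_simps\<close>)
    qed
  qed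
qed

text \<open>With \<open>x\<close> edges of length \<open>1\<close> columns \<open>0\<close> to
  \<open>e\<close> have height \<open>?n + 1\<close>. The order is \<open>0\<close>,
  \<open>x - 1\<close>, down to \<open>4\<close>, and the split triple comes last.\<close>

lemma realization_odd:
  assumes "odd x" "odd e" "3 \<le> e" "e < x" "2 \<le> t" "c \<le> x * k + e"
  shows "\<exists>w. hp3 x t x c {..<(t + 1 + k) * x + (e + 1)} 0 w"
proof -
  let ?n = "t + 1 + k"
  obtain y where y: "x = 2 * y + 1" using assms(1) by (rule oddE)
  obtain z where z: "e = 2 * z + 1" using assms(2) by (rule oddE)
  define m where "m = y - z - 1"
  define m' where "m' = z - 1"
  have x: "x = e + 2 * m + 2" and e: "e = 3 + 2 * m'"
    using y z assms(3,4) by (simp_all add: m_def m'_def)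
  \<comment> \<open>The contributions are \<open>m\<close> pairs with \<open>k\<close> per column,
    \<open>m'\<close> pairs with \<open>k + 1\<close>, and the couple of columns \<open>0\<close>
    and \<open>x - 1\<close> with \<open>k\<close> each; the couple gains one each if
    \<open>?n\<close> is tight.\<close>
  define R where "R = 2 * ((m + m' + 1) * k + m')"
  have "2 * k \<le> R" "even R" by (simp_all add: R_def)
  moreover have "c \<le> R + 3 * k + 3" using assms(6) x e by (simp add: R_def algebra_simps)
  ultimately obtain T D where T: "trip t (Suc ?n) T" "c = T + 2 * D"
    "2 * D \<le> R + (if tight t ?n then 2 else 0)"
    using trip_select assms(5) by metis
  define K where "K = (if tight t ?n then k + 1 else k)"
  define d where "d = min D K"
  define C where "C = min (D - d) (m * k)"
  have C: "d \<le> K" "C \<le> m * k" "d + C \<le> D" "D - d - C \<le> m' * (k + 1)"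
    using T(3) by (auto simp: d_def C_def R_def K_def algebra_simps split: if_splits)
  obtain w where "hp3 x t 3 T (blk x {1..3} {..<Suc ?n}) 3 w"
    using trip_columns[OF T(1), of x] assms by auto
  then have "hp3 x t (3 + 2 * m') (T + 2 * (D - d - C))
      (blk x {3<..3 + 2 * m'} {..<Suc ?n} \<union> blk x {1..3} {..<Suc ?n}) (3 + 2 * m') w"
    by (rule pairs_left[where K = "k + 1", rotated])
      (use x e C lev_exists assms(5) in \<open>auto simp: blk_def\<close>)
  moreover have "blk x {3<..3 + 2 * m'} {..<Suc ?n} \<union> blk x {1..3} {..<Suc ?n} = blk x {1..e} {..<Suc ?n}"
    using e by (auto simp: blk_def)
  ultimately have 1: "hp3 x t e (T + 2 * (D - d - C)) (blk x {1..e} {..<Suc ?n}) e w"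
    using e by simp
  obtain l where l: "lev t d {..<?n} 0 l"
    using lev_exists[of t ?n d] C(1) assms(5) by (auto simp: K_def split: if_splits)
  have "hp3 x t (e + 2 * m + 2) (d + d + 2 * C + (T + 2 * (D - d - C)))
      (blk x {0} {..<Suc ?n} \<union> blk x {e<..<x} {..<?n} \<union> blk x {1..e} {..<Suc ?n}) 0 w"
    by (rule left_frame[OF lev_prepend_lessThan[OF l] l _ C(2) x _ 1])
      (use lev_exists[of t ?n] assms in \<open>auto simp: blk_def\<close>)
  moreover have "blk x {0} {..<Suc ?n} \<union> blk x {e<..<x} {..<?n} \<union> blk x {1..e} {..<Suc ?n}
    = {..<?n * x + (e + 1)}"
  proof -
    have sets: "{..<e + 1} = insert 0 {1..e}" "{e + 1..<x} = {e<..<x}" by auto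
    have "0 < x" "e + 1 \<le> x" using assms(4) by auto
    show ?thesis unfolding lessThan_blk[OF \<open>0 < x\<close> \<open>e + 1 \<le> x\<close>] sets by (auto simp: blk_def)
  qed
  moreover have "d + d + 2 * C + (T + 2 * (D - d - C)) = c" using T(2) C(3) by simp
  ultimately show ?thesis using x by metis
qed

subsection \<open>Standard realizations\<close>

lemma standard_iff_hpath:
  "has_standard_linear_realization M \<longleftrightarrow> (\<exists>w. hpath M {..<size M + 1} 0 w)"
proof -
  have "set p = {0..<size M + 1} \<Longrightarrow> p \<noteq> []" for p by force
  then show ?thesis
    unfolding has_standard_linear_realization_def linear_realization_def hamiltonian_path_K_def
      hpath_def lessThan_atLeast0
    by metis
qed

lemma standard_of_hp3:
  assumes "hp3 x t a c {..<v} 0 w" "v = a + b + c + 1"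
  shows "has_standard_linear_realization
    (replicate_mset a 1 + replicate_mset b x + replicate_mset c (t * x))"
proof -
  obtain b' where
    b': "hpath (replicate_mset a 1 + replicate_mset b' x + replicate_mset c (t * x)) {..<v} 0 w"
    using assms(1) unfolding hp3_def by blast
  have "b' = b" using hpath_size[OF b'] assms(2) by simp
  then show ?thesis unfolding standard_iff_hpath using b' assms(2) by auto
qed

lemma standard_add_one:
  assumes "has_standard_linear_realization M"
  shows "has_standard_linear_realization (add_mset 1 M)"
proof -
  obtain w where "hpath M {..<size M + 1} 0 w" using assms standard_iff_hpath by blast
  from hpath_append[OF hpath_single hpath_shift[OF this], of 0 1]
  have "hpath (add_mset 1 M) ({0} \<union> Suc ` {..<size M + 1}) 0 (Suc w)"
    by (simp add: linear_length_eq)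
  moreover have "{0} \<union> Suc ` {..<size M + 1} = {..<size (add_mset 1 M) + 1}"
    using lessThan_Suc_eq_insert_0[of "size M + 1"] by simp
  ultimately show ?thesis unfolding standard_iff_hpath by metis
qed

lemma standard_mono:
  assumes "has_standard_linear_realization (replicate_mset a 1 + M)" "a \<le> a'"
  shows "has_standard_linear_realization (replicate_mset a' 1 + M)"
  using assms(2) by (induction a' rule: dec_induct) (use assms(1) standard_add_one in auto)

subsection \<open>Lower bounds for \<open>omega\<close>\<close>

text \<open>An edge of length \<open>x\<close> keeps the residue, so only an edge of length
  \<open>1\<close> can bring in a new one.\<close>

lemma card_residues:
  assumes "set_mset (edge_lengths p) \<subseteq> {1, x}" "p \<noteq> []"
  shows "card ((\<lambda>u. u mod x) ` set p) \<le> Suc (count (edge_lengths p) 1)"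
  using assms
proof (induction p)
  case (Cons u p)
  show ?case
  proof (cases "p = []")
    case False
    let ?f = "\<lambda>u. u mod x"
    have IH: "card (?f ` set p) \<le> Suc (count (edge_lengths p) 1)"
      using Cons False by (auto simp: edge_lengths_Cons)
    have l: "linear_length u (hd p) = 1 \<or> linear_length u (hd p) = x"
      using Cons.prems(1) False by (auto simp: edge_lengths_Cons)
    show ?thesis
    proof (cases "linear_length u (hd p) = 1")
      case True
      have "card (?f ` set (u # p)) \<le> Suc (card (?f ` set p))"
        by (simp add: card_insert_le_m1 card_insert_if)
      then show ?thesis using IH True False by (simp add: edge_lengths_Cons)
    next
      case x: False
      then have "u = hd p + x \<or> hd p = u + x" using l by (auto simp: linear_length_eq split: if_splits)
      then have "?f u = ?f (hd p)" by auto
      then have "?f ` set (u # p) = ?f ` set p" using False by auto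
      then show ?thesis using IH x False by (simp add: edge_lengths_Cons)
    qed
  qed simp
qed simp

lemma ones_lower_bound:
  assumes "has_standard_linear_realization (replicate_mset a 1 + replicate_mset d x)"
    and "1 < x" "x \<le> a + d + 1"
  shows "x - 1 \<le> a"
proof -
  obtain p where p: "set p = {0..<a + d + 1}"
    "edge_lengths p = replicate_mset a 1 + replicate_mset d x"
    using assms(1) unfolding has_standard_linear_realization_def linear_realization_def
      hamiltonian_path_K_def by auto
  have "p \<noteq> []" using p(1) by force
  moreover have "set_mset (edge_lengths p) \<subseteq> {1, x}"
    unfolding p(2) by (auto simp: set_mset_replicate_mset_subset split: if_splits)
  ultimately have "card ((\<lambda>u. u mod x) ` set p) \<le> Suc a"
    using card_residues[of p x] p(2) assms(2) by simp
  moreover have "{0..<x} \<subseteq> (\<lambda>u. u mod x) ` set p"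
  proof
    fix y assume "y \<in> {0..<x}"
    then have "y = y mod x" "y \<in> set p" using assms(3) p(1) by auto
    then show "y \<in> (\<lambda>u. u mod x) ` set p" by blast
  qed
  then have "card {0..<x} \<le> card ((\<lambda>u. u mod x) ` set p)" by (intro card_mono) auto
  ultimately show ?thesis by simp
qed

section \<open>Neighbours on a path and the rigidity of extremal realizations\<close>

definition adjacent_in :: "nat list \<Rightarrow> nat \<Rightarrow> nat \<Rightarrow> bool" where
  "adjacent_in p u w \<longleftrightarrow>
    (\<exists>i. Suc i < length p \<and> (p ! i = u \<and> p ! Suc i = w \<or> p ! i = w \<and> p ! Suc i = u))"

lemma adjacent_in_sym: "adjacent_in p u w \<Longrightarrow> adjacent_in p w u"
  unfolding adjacent_in_def by blast

lemma adjacent_in_set: "adjacent_in p u w \<Longrightarrow> u \<in> set p \<and> w \<in> set p"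
  unfolding adjacent_in_def using nth_mem Suc_lessD by blast

lemma edge_lengths_nth:
  "edge_lengths p = mset (map (\<lambda>i. linear_length (p ! i) (p ! Suc i)) [0..<length p - 1])"
proof -
  have "map (\<lambda>(u, w). linear_length u w) (zip p (tl p))
    = map (\<lambda>i. linear_length (p ! i) (p ! Suc i)) [0..<length p - 1]"
    by (rule nth_equalityI) (auto simp: nth_tl)
  then show ?thesis unfolding edge_lengths_def by simp
qed

lemma adjacent_in_length: "adjacent_in p u w \<Longrightarrow> linear_length u w \<in># edge_lengths p"
  unfolding adjacent_in_def edge_lengths_nth by (force simp: linear_length_commute)

lemma adjacent_in_index:
  assumes "distinct p" "i < length p" "adjacent_in p (p ! i) w"
  shows "0 < i \<and> w = p ! (i - 1) \<or> Suc i < length p \<and> w = p ! Suc i"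
proof -
  obtain j where "Suc j < length p" "p ! j = p ! i \<and> p ! Suc j = w \<or> p ! j = w \<and> p ! Suc j = p ! i"
    using assms(3) unfolding adjacent_in_def by blast
  then have "j = i \<and> p ! Suc j = w \<or> p ! j = w \<and> Suc j = i"
    using assms(1,2) by (simp add: nth_eq_iff_index_eq)
  then show ?thesis using \<open>Suc j < length p\<close> by auto
qed

lemma adjacent_in_three:
  assumes "distinct p" "adjacent_in p u a" "adjacent_in p u b" "adjacent_in p u c"
  shows "a = b \<or> a = c \<or> b = c"
proof -
  obtain i where i: "i < length p" "p ! i = u"
    using adjacent_in_set[OF assms(2)] by (auto simp: in_set_conv_nth)
  show ?thesis using adjacent_in_index[OF assms(1) i(1)] assms(2-4) unfolding i(2) by blast
qed

lemma adjacent_in_hd: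
  assumes "distinct p" "adjacent_in p (hd p) a" "adjacent_in p (hd p) b"
  shows "a = b"
proof -
  have "p \<noteq> []" using adjacent_in_set[OF assms(2)] by auto
  then show ?thesis using adjacent_in_index[of p 0] assms by (auto simp: hd_conv_nth)
qed

lemma adjacent_in_inner:
  assumes "distinct p" "u \<in> set p" "u \<noteq> hd p" "u \<noteq> last p"
  obtains a b where "a \<noteq> b" "adjacent_in p u a" "adjacent_in p u b"
proof -
  obtain i where i: "i < length p" "p ! i = u" using assms(2) by (auto simp: in_set_conv_nth)
  have "p \<noteq> []" using assms(2) by auto
  have "i \<noteq> 0" using i assms(3) hd_conv_nth[OF \<open>p \<noteq> []\<close>] by metis
  moreover have "Suc i \<noteq> length p"
    using i assms(4) last_conv_nth[OF \<open>p \<noteq> []\<close>] by (metis diff_Suc_1)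
  ultimately have "0 < i" "Suc i < length p" using i by auto
  have "adjacent_in p u (p ! (i - 1))"
    unfolding adjacent_in_def by (rule exI[of _ "i - 1"]) (use i \<open>0 < i\<close> in auto)
  moreover have "adjacent_in p u (p ! Suc i)"
    unfolding adjacent_in_def by (rule exI[of _ i]) (use i \<open>Suc i < length p\<close> in auto)
  moreover have "p ! (i - 1) \<noteq> p ! Suc i"
    using assms(1) \<open>Suc i < length p\<close> by (simp add: nth_eq_iff_index_eq)
  ultimately show thesis using that by blast
qed

lemma adjacent_in_crossing:
  assumes "w \<in> set p" "w \<in> W" "hd p \<notin> W"
  obtains u w' where "u \<in> W" "w' \<notin> W" "adjacent_in p u w'"
proof -
  define i where "i = (LEAST i. i < length p \<and> p ! i \<in> W)"
  have ex: "\<exists>i. i < length p \<and> p ! i \<in> W" using assms(1,2) by (auto simp: in_set_conv_nth)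
  have i: "i < length p \<and> p ! i \<in> W" unfolding i_def by (rule LeastI_ex[OF ex])
  have "p \<noteq> []" using assms(1) by auto
  have "i \<noteq> 0" using i assms(3) hd_conv_nth[OF \<open>p \<noteq> []\<close>] by metis
  then have "\<not> (i - 1 < length p \<and> p ! (i - 1) \<in> W)"
    unfolding i_def by (intro not_less_Least) simp
  then have "p ! (i - 1) \<notin> W" using i by auto
  moreover have "adjacent_in p (p ! i) (p ! (i - 1))"
    unfolding adjacent_in_def by (rule exI[of _ "i - 1"]) (use i \<open>i \<noteq> 0\<close> in auto)
  ultimately show thesis using that i by blast
qed

text \<open>
  There are only \<open>d\<close> pairs of vertices at distance \<open>x\<close>, so all of them are edges of the path.
\<close>

lemma all_long_edges:
  assumes "distinct p" "set p = {0..<d + x}" "count (edge_lengths p) x = d" "0 < x" "u < d"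
  shows "adjacent_in p u (u + x)"
proof -
  define I where "I = {i. i < length p - 1 \<and> linear_length (p ! i) (p ! Suc i) = x}"
  \<comment> \<open>A long edge is determined by its lower end; this gives an injection of
    \<open>d\<close> edges into \<open>d\<close> possible lower ends, hence a bijection.\<close>
  define f where "f i = min (p ! i) (p ! Suc i)" for i
  have f: "f i + x = max (p ! i) (p ! Suc i)" if "i \<in> I" for i
    using that by (auto simp: I_def f_def linear_length_eq split: if_splits)
  have len: "length p = d + x" using distinct_card[OF assms(1)] assms(2) by simp
  have nth: "p ! i < d + x" if "i < length p" for i using nth_mem[OF that] assms(2) by auto
  let ?es = "map (\<lambda>i. linear_length (p ! i) (p ! Suc i)) [0..<length p - 1]"
  have "d = size (filter_mset (\<lambda>y. y = x) (mset ?es))"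
    using assms(3) unfolding edge_lengths_nth filter_eq_replicate_mset by simp
  also have "\<dots> = length (filter (\<lambda>y. y = x) ?es)" by (metis mset_filter size_mset)
  also have "\<dots> = card {i. i < length ?es \<and> ?es ! i = x}" by (rule length_filter_conv_card)
  also have "{i. i < length ?es \<and> ?es ! i = x} = I" by (auto simp: I_def)
  finally have card: "card I = d" by simp
  have "inj_on f I"
  proof (rule inj_onI)
    fix i j assume ij: "i \<in> I" "j \<in> I" "f i = f j"
    have l: "Suc i < length p" "Suc j < length p" using ij by (auto simp: I_def)
    have "max (p ! i) (p ! Suc i) = max (p ! j) (p ! Suc j)" using f ij by metis
    then have "p ! i = p ! j \<or> p ! i = p ! Suc j \<and> p ! Suc i = p ! j"
      using ij(3) by (auto simp: f_def min_def max_def split: if_splits)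
    then have "i = j \<or> i = Suc j \<and> Suc i = j"
      using assms(1) l by (simp add: nth_eq_iff_index_eq)
    then show "i = j" by auto
  qed
  then have "card (f ` I) = d" using card by (simp add: card_image)
  moreover have "f ` I \<subseteq> {0..<d}"
  proof
    fix y assume "y \<in> f ` I"
    then obtain i where i: "i \<in> I" "y = f i" by blast
    then have "Suc i < length p" by (auto simp: I_def)
    then have "max (p ! i) (p ! Suc i) < d + x" using nth[of i] nth[of "Suc i"] by auto
    then show "y \<in> {0..<d}" using f[OF i(1)] i(2) by auto
  qed
  ultimately have "f ` I = {0..<d}" by (intro card_subset_eq) auto
  then obtain i where i: "i \<in> I" "u = f i" using assms(5) by (metis atLeast0LessThan imageE lessThan_iff)
  then have "p ! i = u \<and> p ! Suc i = u + x \<or> p ! i = u + x \<and> p ! Suc i = u"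
    using f[OF i(1)] by (auto simp: f_def min_def max_def split: if_splits)
  moreover have "Suc i < length p" using i(1) by (auto simp: I_def)
  ultimately show ?thesis unfolding adjacent_in_def by blast
qed

lemma mod_eq_imp_eq:
  fixes u w x :: nat
  assumes "u mod x = w mod x" "u < w + x" "w < u + x"
  shows "u = w"
proof (cases "u \<le> w")
  case True
  then have "x dvd w - u" using assms(1) by (simp add: mod_eq_dvd_iff_nat[symmetric])
  then show ?thesis using assms(3) True by (auto dest: dvd_imp_le)
next
  case False
  then have "x dvd u - w" using assms(1) by (simp add: mod_eq_dvd_iff_nat[symmetric])
  then show ?thesis using assms(2) False by (auto dest: dvd_imp_le)
qed

text \<open>
  With \<open>x - 1\<close> edges of length \<open>1\<close>, such an edge can only join vertices of the bottom row
  \<open>{0..<x}\<close> or of the top row \<open>{d..<d + x}\<close>, and every vertex of these rows except \<open>0\<close> and the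
  end of the path is on exactly one of them. This determines the edges; for odd
  \<open>d mod x \<ge> 3\<close> two adjacent columns are then joined both at the bottom and at the top, which
  closes a cycle.
\<close>

lemma no_realization_odd_residue:
  assumes st: "has_standard_linear_realization (replicate_mset (x - 1) 1 + replicate_mset d x)"
    and x: "odd x" "1 < x" "2 * x \<le> d" and r: "odd (d mod x)" "d mod x \<noteq> 1"
  shows False
proof -
  have size: "size (replicate_mset (x - 1) 1 + replicate_mset d x) + 1 = d + x" using x by simp
  obtain p where p: "distinct p" "set p = {0..<d + x}" "hd p = 0"
    "edge_lengths p = replicate_mset (x - 1) 1 + replicate_mset d x"
    using st unfolding has_standard_linear_realization_def linear_realization_def
      hamiltonian_path_K_def size by auto
  let ?adj = "adjacent_in p"
  define A where "A u \<longleftrightarrow> ?adj u (Suc u)" for u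
  define z where "z = last p"
  have vert: "?adj u (u + x)" if "u < d" for u
    by (rule all_long_edges[OF p(1,2)]) (use p(4) x that in auto)
  have vert': "?adj u (u - x)" if "x \<le> u" "u < d + x" for u
    using adjacent_in_sym[OF vert[of "u - x"]] that by simp
  have nbrs: "w = Suc u \<or> u = Suc w \<or> w = u + x \<or> u = w + x" if "?adj u w" for u w
    using adjacent_in_length[OF that] x(2) unfolding p(4)
    by (auto simp: linear_length_eq in_replicate_mset split: if_splits)
  have lt: "u < d + x" "w < d + x" if "?adj u w" for u w
    using adjacent_in_set[OF that] p(2) by auto
  note three = adjacent_in_three[OF p(1)]
  have full: "w = u + x \<or> u = w + x" if "x \<le> u" "u < d" "?adj u w" for u w
    using three[OF vert[of u] vert'[of u] that(3)] that x by auto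
  have A0: "\<not> A 0"
  proof
    assume "A 0"
    then have "Suc 0 = 0 + x"
      using adjacent_in_hd[OF p(1), of "Suc 0" "0 + x"] vert[of 0] x p(3) unfolding A_def by simp
    then show False using x by simp
  qed
  have alt: "A (Suc u) \<longleftrightarrow> \<not> A u"
    if u: "Suc u < x \<or> d \<le> Suc u" "Suc u < d + x" "Suc u \<noteq> z" for u
  proof -
    define y where "y = (if Suc u < x then Suc u + x else Suc u - x)"
    have y: "?adj (Suc u) y" "y \<noteq> u" "y \<noteq> Suc (Suc u)"
      using vert[of "Suc u"] vert'[of "Suc u"] that x by (auto simp: y_def)
    have only: "w = y \<or> w = u \<or> w = Suc (Suc u)" if w: "?adj (Suc u) w" for w
      using nbrs[OF w] lt[OF w] u(1) x by (auto simp: y_def)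
    obtain a b where ab: "a \<noteq> b" "?adj (Suc u) a" "?adj (Suc u) b"
      by (rule adjacent_in_inner[OF p(1), of "Suc u"]) (use u p(2,3) in \<open>auto simp: z_def\<close>)
    have "?adj (Suc u) u \<or> ?adj (Suc u) (Suc (Suc u))" using ab only by metis
    moreover have "\<not> (?adj (Suc u) u \<and> ?adj (Suc u) (Suc (Suc u)))"
      using three[OF y(1), of u "Suc (Suc u)"] y by auto
    ultimately show ?thesis unfolding A_def using adjacent_in_sym by blast
  qed
  have Atop: "\<not> A (d + x - 1)"
  proof
    assume "A (d + x - 1)"
    from lt(2)[OF this[unfolded A_def]] show False using x by simp
  qed
  have Ad: "\<not> A (d - 1)"
  proof
    assume "A (d - 1)"
    then have "?adj (d - 1) d" using x unfolding A_def by simp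
    moreover have "x \<le> d - 1" "d - 1 < d" using x by linarith+
    ultimately have "d = d - 1 + x \<or> d - 1 = d + x" by (intro full)
    then show False using x by linarith
  qed
  \<comment> \<open>If the path ended below the top row, the alternation would run down all of that
    row. Its \<open>x\<close> changes, an odd number, would force the edge from \<open>d - 1\<close>
    to \<open>d\<close>.\<close>
  have z: "d \<le> z"
  proof (rule ccontr)
    assume "\<not> d \<le> z"
    have "i \<le> x \<Longrightarrow> A (d + x - 1 - i) \<longleftrightarrow> odd i" for i
    proof (induction i)
      case 0
      then show ?case using Atop by simp
    next
      case (Suc i)
      define y where "y = d + x - 1 - Suc i"
      have y: "Suc y = d + x - 1 - i" using Suc.prems x by (simp add: y_def)
      then have "d \<le> Suc y" "Suc y < d + x" using Suc.prems x by linarith+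
      then have "A (Suc y) \<longleftrightarrow> \<not> A y" using alt[of y] \<open>\<not> d \<le> z\<close> by auto
      moreover have "A (Suc y) \<longleftrightarrow> odd i" unfolding y using Suc by simp
      ultimately have "A y \<longleftrightarrow> odd (Suc i)" by simp
      then show ?case unfolding y_def .
    qed
    from this[of x] show False using Ad x by simp
  qed
  have bottom: "u < x \<Longrightarrow> A u \<longleftrightarrow> odd u" for u
  proof (induction u)
    case (Suc u)
    then show ?case using alt[of u] z x by auto
  qed (use A0 in simp)
  have closed: False if j: "0 < j" "Suc j < x" "odd j"
    and T: "d \<le> T" "Suc T < d + x" "T mod x = j" "A T" for j T
  proof -
    have "Suc T mod x = Suc j" using j T by (simp add: mod_Suc)
    \<comment> \<open>Instead of exhibiting the cycle, it is shown that no edge of the path leaves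
      the two columns, although the path starts outside them.\<close>
    define W where "W = {u. u mod x = j \<or> u mod x = Suc j}"
    have "T \<in> set p" "T \<in> W" "hd p \<notin> W" using p(2,3) T j by (auto simp: W_def)
    then obtain u w where uw: "u \<in> W" "w \<notin> W" "?adj u w" by (rule adjacent_in_crossing)
    have w: "w \<noteq> u + x" "u \<noteq> w + x" using uw(1,2) by (auto simp: W_def)
    have adj: "?adj j (Suc j)" "?adj T (Suc T)" using bottom j T(4) by (auto simp: A_def)
    consider "u < x" | "x \<le> u" "u < d" | "d \<le> u" by linarith
    then show False
    proof cases
      case 1
      then have "u = j \<or> u = Suc j" using uw(1) by (auto simp: W_def)
      then obtain y where y: "?adj u y" "y \<in> W" "y < x"
        using adj(1) adjacent_in_sym j by (fastforce simp: W_def)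
      have "?adj u (u + x)" using vert[of u] 1 x by simp
      from three[OF this y(1) uw(3)] show False using w y uw(2) by auto
    next
      case 2
      from full[OF this uw(3)] show False using w by auto
    next
      case 3
      then have "u = T \<or> u = Suc T"
        using uw(1) mod_eq_imp_eq[of u x T] mod_eq_imp_eq[of u x "Suc T"] T \<open>Suc T mod x = Suc j\<close> lt[OF uw(3)]
        by (auto simp: W_def)
      then obtain y where y: "?adj u y" "y \<in> W" "d \<le> y"
        using adj(2) adjacent_in_sym T \<open>Suc T mod x = Suc j\<close> by (fastforce simp: W_def)
      have "?adj u (u - x)" using vert'[of u] 3 x lt[OF uw(3)] by simp
      moreover have "u - x \<noteq> y" "u - x \<noteq> w" using y(3) w 3 lt[OF uw(3)] x by auto
      ultimately show False using three[OF _ y(1) uw(3)] y uw(2) by blast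
    qed
  qed
  define e where "e = d mod x"
  have e3: "3 \<le> e" "Suc e < x" "odd e"
  proof -
    have "e < x" "odd e" "e \<noteq> 1" using x r by (simp_all add: e_def)
    then show "3 \<le> e" "Suc e < x" "odd e" using x(1) by presburger+
  qed
  show False
  \<comment> \<open>If \<open>d\<close> is not the end, alternation from the left end of the top row
    gives the edge from \<open>d\<close> to \<open>d + 1\<close>, in columns \<open>e\<close> and
    \<open>e + 1\<close>. Otherwise alternation from the right end gives such an edge in columns
    \<open>e - 2\<close> and \<open>e - 1\<close>.\<close>
  proof (cases "z = d")
    case False
    have "A d \<longleftrightarrow> \<not> A (d - 1)" using alt[of "d - 1"] False x by simp
    then have "A d" using Ad by simp
    show False by (rule closed[OF _ _ _ _ _ e_def[symmetric] \<open>A d\<close>]) (use e3 x in auto)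
  next
    case True
    have T: "Suc (d + x - 2) = d + x - 1" using x by simp
    have "A (d + x - 1) \<longleftrightarrow> \<not> A (d + x - 2)"
    proof -
      have "d \<le> d + x - 1" "d + x - 1 < d + x" "d + x - 1 \<noteq> z" using True x by linarith+
      then show ?thesis using alt[of "d + x - 2"] unfolding T by blast
    qed
    moreover have "(d + x - 2) mod x = e - 2"
    proof -
      have "d = d div x * x + e" by (simp add: e_def)
      then have "d + x - 2 = (e - 2) + (d div x + 1) * x" using e3 by simp
      then have "(d + x - 2) mod x = (e - 2) mod x" by (simp only: mod_mult_self1)
      then show ?thesis using e3 by simp
    qed
    moreover have "0 < e - 2" "Suc (e - 2) < x" "odd (e - 2)" using e3 by auto
    moreover have "d \<le> d + x - 2" "Suc (d + x - 2) < d + x" using x by auto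
    ultimately show False using closed[of "e - 2" "d + x - 2"] Atop by blast
  qed
qed

section \<open>Construction and lower bound combined\<close>

lemma standard_core:
  assumes "odd x" "1 < x" "2 \<le> t" "t * x \<le> b"
    and a: "a = (if even ((b + c) mod x) \<or> (b + c) mod x = 1 then x - 1 else x)"
  shows "has_standard_linear_realization
    (replicate_mset a 1 + replicate_mset b x + replicate_mset c (t * x))"
proof -
  define d where "d = b + c"
  define e where "e = d mod x"
  define k where "k = d div x - t"
  have "t \<le> d div x" using assms(2,4) by (simp add: d_def less_eq_div_iff_mult_less_eq)
  then have d: "d = (t + k) * x + e" by (simp add: k_def e_def)
  have e: "e < x" using assms(2) by (simp add: e_def)
  have c: "c \<le> x * k + e" using d assms(4) by (simp add: d_def algebra_simps)
  consider "even e" | "e = 1" | "odd e" "e \<noteq> 1" by blast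
  then obtain v w where "hp3 x t a c {..<v} 0 w" "v = a + d + 1"
  proof cases
    case 1
    have "a = x - 1" using a 1 by (simp add: d_def e_def)
    moreover have "(t + 1 + k) * x + e = x - 1 + d + 1" using d assms(2) by (simp add: algebra_simps)
    ultimately show thesis using that realization_even[OF assms(1) 1 e assms(3) c] by metis
  next
    case 2
    have "a = x - 1" using a 2 by (simp add: d_def e_def)
    moreover have "(t + 1 + k) * x + 1 = x - 1 + d + 1" using d 2 assms(2) by (simp add: algebra_simps)
    ultimately show thesis
      using that realization_one[OF assms(1-3), of c k] c 2 by metis
  next
    case 3
    then have "3 \<le> e" by presburger
    have "a = x" using a 3 by (simp add: d_def e_def)
    moreover have "(t + 1 + k) * x + (e + 1) = x + d + 1" using d by (simp add: algebra_simps)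
    ultimately show thesis
      using that realization_odd[OF assms(1) 3(1) \<open>3 \<le> e\<close> e assms(3) c] by metis
  qed
  then show ?thesis using standard_of_hp3[of x t a c v w b] by (simp add: d_def)
qed

lemma omega_ge:
  assumes "odd x" "1 < x" "2 * x \<le> d"
  shows "(if even (d mod x) \<or> d mod x = 1 then x - 1 else x) \<le> omega x d"
proof -
  define P where "P a \<longleftrightarrow> has_standard_linear_realization (replicate_mset a 1 + replicate_mset d x)" for a
  \<comment> \<open>The least element in \<open>omega\<close> satisfies its property only if some
    realization exists; the construction supplies one with no edges of the third length.\<close>
  have "\<exists>a. P a"
    using standard_core[of x 2 d _ 0, OF assms(1,2) _ assms(3) refl] by (auto simp: P_def)
  then have "P (omega x d)" unfolding omega_def P_def by (rule LeastI_ex)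
  then have P: "has_standard_linear_realization (replicate_mset (omega x d) 1 + replicate_mset d x)"
    by (simp add: P_def)
  have "x - 1 \<le> omega x d" by (rule ones_lower_bound[OF P]) (use assms in auto)
  moreover have "omega x d \<noteq> x - 1" if "odd (d mod x)" "d mod x \<noteq> 1"
    using no_realization_odd_residue[OF _ assms that] P by metis
  ultimately show ?thesis by auto
qed

theorem theorem4p6:
  fixes x t a b c v q r s :: nat and L :: "nat multiset"
  assumes "odd x" and "x > 1" and "t \<ge> 2" and "b + c \<ge> 1"
    and "L = replicate_mset a 1 + replicate_mset b x + replicate_mset c (t * x)"
    and "v = a + b + c + 1" and "v \<ge> (t + 2) * x"
    and "v = q * x + r" and "r < x"
    and "s = q div (2 * t)"
    and "a \<ge> omega x (b + c)"
    and "(even r \<and> b \<ge> t * x)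
       \<or> (odd r \<and> odd t \<and> int b \<ge> int (t * x) + 2 * int t - 3)
       \<or> (odd r \<and> even t \<and> int b \<ge> 4 * int s + int (t * x) + 4 * int t - 9)"
  shows "has_standard_linear_realization L"
proof -
  \<comment> \<open>For \<open>t \<ge> 3\<close> the additional terms are nonnegative. For
    \<open>t = 2\<close> the term \<open>4 * t - 9\<close> is \<open>-1\<close>, compensated by
    \<open>s \<ge> 1\<close>, which follows from \<open>v \<ge> 4 * x\<close>.\<close>
  have b: "t * x \<le> b"
  proof (cases "t = 2")
    case False
    then have "3 \<le> int t" using assms(3) by simp
    then show ?thesis using assms(12) by (auto simp del: of_nat_mult)
  next
    case True
    have "(t + 2) * x = 4 * x" "(q + 1) * x = q * x + x" using True by simp_all
    then have "4 * x < (q + 1) * x" using assms(7-9) by linarith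
    then have "4 \<le> q" by simp
    then have "1 \<le> s" using assms(10) True by simp
    then show ?thesis using assms(12) True by (auto simp del: of_nat_mult)
  qed
  define a0 where "a0 = (if even ((b + c) mod x) \<or> (b + c) mod x = 1 then x - 1 else x)"
  have "2 * x \<le> t * x" using assms(3) by (rule mult_le_mono1)
  then have "2 * x \<le> b + c" using b by linarith
  from omega_ge[OF assms(1,2) this] assms(11) have "a0 \<le> a" unfolding a0_def by (rule order_trans)
  moreover have "has_standard_linear_realization
      (replicate_mset a0 1 + (replicate_mset b x + replicate_mset c (t * x)))"
    using standard_core[OF assms(1-3) b a0_def] by (simp add: add.assoc)
  ultimately show ?thesis
    unfolding assms(5) using standard_mono by (simp add: add.assoc)
qed

end
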